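(* The natural homomorphism $\mathrm{Com}(F)\to QI(F)$ from the abstract commensurator of Thompson's group $F$ to the quasi-isometry group of $F$ is injective.
   Context: Thompson's group $F$ is the (finitely generated) group, under composition, of all order-preserving homeomorphisms $f\colon\mathbb{R}\to\mathbb{R}$ that are piecewise linear with a discrete set of breakpoints (finitely many in every bounded interval), all breakpoints in $\mathbb{Z}[\frac12]$, all slopes integral powers of $2$, $f(\mathbb{Z}[\frac12])\subset\mathbb{Z}[\frac12]$, and for which there exist integers $l,r$ and a real $M>0$ with $f(t)=t+r$ for all $t>M$ and $f(t)=t+l$ for all $t<-M$. A commensuration of a group $G$ is an isomorphism $\alpha\colon A\to B$ between subgroups $A,B$ of finite index in $G$. Two commensurations are equivalent if they agree on some subgroup of finite index in $G$. The product $\beta\circ\alpha$ of $\alpha\colon A\to B$ and $\beta\colon C\to D$ is defined on $\alpha^{-1}(B\cap C)$. The equivalence classes with this product form the group $\mathrm{Com}(G)$. For a finitely generated group $G$ with a word metric $d$ coming from a finite generating set, two quasi-isometries $f,g\colon G\to G$ are equivalent if there is $M>0$ such that $d(f(t),g(t))\le M$ for all $t\in G$. The equivalence classes, under composition, form the group $QI(G)$. The natural homomorphism $\mathrm{Com}(G)\to QI(G)$ sends the class of a commensuration $\alpha\colon A\to B$ to the class of the quasi-isometry $G\to A\xrightarrow{\alpha}B\hookrightarrow G$, where $G\to A$ is any map moving each point a uniformly bounded distance (a quasi-inverse of the inclusion $A\hookrightarrow G$, which is a quasi-isometry because $A$ has finite index). *)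

theory Defs
  imports "HOL-Analysis.Analysis" "HOL-Algebra.Generated_Groups"
begin

section \<open>Thompson's group \<open>F\<close>\<close>

definition dyadic_rationals :: "real set" where
  "dyadic_rationals = {of_int m / 2 ^ n | (m :: int) (n :: nat). True}"

definition affine_near :: "(real \<Rightarrow> real) \<Rightarrow> real \<Rightarrow> real \<Rightarrow> bool" where
  "affine_near f x a \<longleftrightarrow> (\<exists>b. \<forall>\<^sub>F t in nhds x. f t = a * t + b)"

definition breakpoints :: "(real \<Rightarrow> real) \<Rightarrow> real set" where
  "breakpoints f = {x. \<nexists>a. affine_near f x a}"

text \<open>
  Piecewise linearity with a discrete set of breakpoints is the local finiteness of
  \<^const>\<open>breakpoints\<close>: on each component of the complement, \<open>f\<close> is locally affine, hence affine.
\<close>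

definition thompson_homeos :: "(real \<Rightarrow> real) set" where
  "thompson_homeos = {f.
     (\<exists>g. homeomorphism UNIV UNIV f g) \<and> strict_mono f \<and>
     (\<forall>a b. finite (breakpoints f \<inter> {a..b})) \<and>
     breakpoints f \<subseteq> dyadic_rationals \<and>
     (\<forall>x a. affine_near f x a \<longrightarrow> (\<exists>k::int. a = 2 powi k)) \<and>
     f ` dyadic_rationals \<subseteq> dyadic_rationals \<and>
     (\<exists>(l::int) (r::int) (M::real). M > 0 \<and>
        (\<forall>t>M. f t = t + of_int r) \<and> (\<forall>t< -M. f t = t + of_int l))}"

definition Thompson_F :: "(real \<Rightarrow> real) monoid" where
  "Thompson_F = \<lparr>carrier = thompson_homeos, mult = (\<lambda>f g. f \<circ> g), one = id\<rparr>"


section \<open>The abstract commensurator\<close>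

definition finite_index_subgroup :: "'a set \<Rightarrow> ('a, 'b) monoid_scheme \<Rightarrow> bool" where
  "finite_index_subgroup A G \<longleftrightarrow> subgroup A G \<and> finite (rcosets\<^bsub>G\<^esub> A)"

text \<open>
  A commensuration \<open>\<alpha>: A \<rightarrow> B\<close> is the triple \<open>(A, B, \<alpha>)\<close>; requiring \<open>\<alpha>\<close> to be extensional makes
  the triple independent of irrelevant values outside \<open>A\<close>.
\<close>

type_synonym 'a partial_map = "'a set \<times> 'a set \<times> ('a \<Rightarrow> 'a)"

definition commensurations :: "('a, 'b) monoid_scheme \<Rightarrow> 'a partial_map set" where
  "commensurations G = {(A, B, \<alpha>).
     finite_index_subgroup A G \<and> finite_index_subgroup B G \<and>
     \<alpha> \<in> iso (G\<lparr>carrier := A\<rparr>) (G\<lparr>carrier := B\<rparr>) \<and> \<alpha> \<in> extensional A}"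

definition com_equiv :: "('a, 'b) monoid_scheme \<Rightarrow> ('a partial_map \<times> 'a partial_map) set" where
  "com_equiv G = {((A, B, \<alpha>), (C, D, \<beta>)).
     (A, B, \<alpha>) \<in> commensurations G \<and> (C, D, \<beta>) \<in> commensurations G \<and>
     (\<exists>H. finite_index_subgroup H G \<and> H \<subseteq> A \<inter> C \<and> (\<forall>x\<in>H. \<alpha> x = \<beta> x))}"

text \<open>The product \<open>\<beta> \<circ> \<alpha>\<close>, an isomorphism from \<open>\<alpha>\<^sup>-\<^sup>1(B \<inter> C)\<close> onto \<open>\<beta>(B \<inter> C)\<close>.\<close>

fun com_comp :: "'a partial_map \<Rightarrow> 'a partial_map \<Rightarrow> 'a partial_map" where
  "com_comp (C, D, \<beta>) (A, B, \<alpha>) =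
     (let E = {x \<in> A. \<alpha> x \<in> B \<inter> C} in (E, \<beta> ` (B \<inter> C), compose E \<beta> \<alpha>))"

definition Com :: "('a, 'b) monoid_scheme \<Rightarrow> 'a partial_map set monoid" where
  "Com G = \<lparr>
     carrier = commensurations G // com_equiv G,
     mult = (\<lambda>X Y. \<Union>b\<in>X. \<Union>a\<in>Y. com_equiv G `` {com_comp b a}),
     one = com_equiv G `` {(carrier G, carrier G, \<lambda>x\<in>carrier G. x)}\<rparr>"


section \<open>The quasi-isometry group\<close>

definition word_length :: "('a, 'b) monoid_scheme \<Rightarrow> 'a set \<Rightarrow> 'a \<Rightarrow> nat" where
  "word_length G S g =
     (LEAST n. \<exists>w. length w = n \<and> set w \<subseteq> S \<union> (m_inv G) ` S \<and>
                   foldr (\<lambda>x y. x \<otimes>\<^bsub>G\<^esub> y) w \<one>\<^bsub>G\<^esub> = g)"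

definition word_metric :: "('a, 'b) monoid_scheme \<Rightarrow> 'a set \<Rightarrow> 'a \<Rightarrow> 'a \<Rightarrow> real" where
  "word_metric G S g h = real (word_length G S (inv\<^bsub>G\<^esub> g \<otimes>\<^bsub>G\<^esub> h))"

definition finite_generating_set :: "('a, 'b) monoid_scheme \<Rightarrow> 'a set \<Rightarrow> bool" where
  "finite_generating_set G S \<longleftrightarrow> finite S \<and> S \<subseteq> carrier G \<and> generate G S = carrier G"

definition quasi_isometries :: "'a set \<Rightarrow> ('a \<Rightarrow> 'a \<Rightarrow> real) \<Rightarrow> ('a \<Rightarrow> 'a) set" where
  "quasi_isometries X d = {f \<in> X \<rightarrow>\<^sub>E X. \<exists>K\<ge>1. \<exists>C\<ge>0.
     (\<forall>x\<in>X. \<forall>y\<in>X. d x y / K - C \<le> d (f x) (f y) \<and> d (f x) (f y) \<le> K * d x y + C) \<and>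
     (\<forall>y\<in>X. \<exists>x\<in>X. d (f x) y \<le> C)}"

definition qi_equiv :: "'a set \<Rightarrow> ('a \<Rightarrow> 'a \<Rightarrow> real) \<Rightarrow> (('a \<Rightarrow> 'a) \<times> ('a \<Rightarrow> 'a)) set" where
  "qi_equiv X d = {(f, g). f \<in> quasi_isometries X d \<and> g \<in> quasi_isometries X d \<and>
     (\<exists>M>0. \<forall>t\<in>X. d (f t) (g t) \<le> M)}"

definition QI_space :: "'a set \<Rightarrow> ('a \<Rightarrow> 'a \<Rightarrow> real) \<Rightarrow> ('a \<Rightarrow> 'a) set monoid" where
  "QI_space X d = \<lparr>
     carrier = quasi_isometries X d // qi_equiv X d,
     mult = (\<lambda>U V. \<Union>f\<in>U. \<Union>g\<in>V. qi_equiv X d `` {compose X f g}),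
     one = qi_equiv X d `` {\<lambda>x\<in>X. x}\<rparr>"

definition QI :: "('a, 'b) monoid_scheme \<Rightarrow> 'a set \<Rightarrow> ('a \<Rightarrow> 'a) set monoid" where
  "QI G S = QI_space (carrier G) (word_metric G S)"


section \<open>The natural homomorphism\<close>

definition bounded_maps_into ::
    "('a, 'b) monoid_scheme \<Rightarrow> 'a set \<Rightarrow> 'a set \<Rightarrow> ('a \<Rightarrow> 'a) set" where
  "bounded_maps_into G S A =
     {p \<in> carrier G \<rightarrow>\<^sub>E A. \<exists>M. \<forall>x\<in>carrier G. word_metric G S (p x) x \<le> M}"

text \<open>
  The value at a class \<open>c\<close> is the union of the classes of \<open>\<alpha> \<circ> p\<close> over all representatives
  \<open>\<alpha>: A \<rightarrow> B\<close> of \<open>c\<close> and all maps \<open>p: G \<rightarrow> A\<close> of bounded displacement; membership of this union in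
  the carrier of \<^term>\<open>QI G S\<close> expresses independence of these choices.
\<close>

definition Com_to_QI ::
    "('a, 'b) monoid_scheme \<Rightarrow> 'a set \<Rightarrow> 'a partial_map set \<Rightarrow> ('a \<Rightarrow> 'a) set" where
  "Com_to_QI G S c = (\<Union>(A, B, \<alpha>)\<in>c. \<Union>p\<in>bounded_maps_into G S A.
     qi_equiv (carrier G) (word_metric G S) `` {compose (carrier G) \<alpha> p})"

end

theory Submission imports Defs begin

text \<open>
  The argument works for every finitely generated group \<open>G\<close>. A commensuration maps pairs at bounded
  distance to pairs at bounded distance because balls are finite; applying this also to its inverse
  shows that it induces a quasi-isometry of \<open>G\<close>, well defined up to bounded distance. If two
  commensurations \<open>\<alpha>\<close> and \<open>\<beta>\<close> induce equivalent quasi-isometries, then \<open>\<alpha>(x)\<^sup>-\<^sup>1 \<beta>(x)\<close> takes only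
  finitely many values on the common domain. Two points with the same value lie in the same
  right coset of the subgroup \<open>{x. \<alpha>(x) = \<beta>(x)}\<close>, which therefore has finite index.
\<close>

text \<open>The distance of x and y is the length of x^-1 y, hence invariant under left
  multiplication. Both finiteness steps rest on this: for a homomorphism \<alpha>, the distance of
  \<alpha>(x) and \<alpha>(y) depends on x^-1 y alone, and a bounded distance between \<alpha>(x)
  and \<beta>(x) confines \<alpha>(x)^-1 \<beta>(x) to a ball. If this element is c at both x and y,
  then \<beta>(x) \<beta>(y)^-1 = \<alpha>(x) c c^-1 \<alpha>(y)^-1 = \<alpha>(x) \<alpha>(y)^-1, so
  \<alpha> and \<beta> agree at x y^-1. That the map is a group homomorphism includes that Com(F)
  and QI(F) are groups, and the general argument needs F itself to be one. There the obstacle is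
  that breakpoints and slopes are local notions: breakpoints of f and g may cancel in the composite,
  whose slope is then not a product of slopes at that place; it is computed at a nearby point
  instead. Moreover, the definition only asks f to map dyadic rationals to dyadic rationals, so the
  same property of the inverse has to be derived.\<close>

section \<open>Groups as quotients of a set with a product up to equivalence\<close>

text \<open>Shared by Com(G) and QI(G): in both, the product of representatives satisfies the group
  laws only modulo the equivalence. Congruence makes all sets in the union defining the product
  coincide, which reduces each law to representatives.\<close>

lemma quotient_group:
  assumes R: "equiv X R"
    and cl: "\<And>a b. a \<in> X \<Longrightarrow> b \<in> X \<Longrightarrow> f a b \<in> X"
    and cong: "\<And>a a' b b'. (a, a') \<in> R \<Longrightarrow> (b, b') \<in> R \<Longrightarrow> (f a b, f a' b') \<in> R"
    and assoc: "\<And>a b c. a \<in> X \<Longrightarrow> b \<in> X \<Longrightarrow> c \<in> X \<Longrightarrow> (f (f a b) c, f a (f b c)) \<in> R"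
    and e: "e \<in> X" "\<And>a. a \<in> X \<Longrightarrow> (f e a, a) \<in> R"
    and inv: "\<And>a. a \<in> X \<Longrightarrow> \<exists>b\<in>X. (f b a, e) \<in> R"
  defines "M \<equiv> \<lparr>carrier = X // R, mult = (\<lambda>U V. \<Union>a\<in>U. \<Union>b\<in>V. R `` {f a b}), one = R `` {e}\<rparr>"
  shows quotient_group_is_group: "group M"
    and quotient_group_mult: "\<And>a b. a \<in> X \<Longrightarrow> b \<in> X \<Longrightarrow> (R `` {a}) \<otimes>\<^bsub>M\<^esub> (R `` {b}) = R `` {f a b}"
proof -
  have c2: "congruent2 R R (\<lambda>a b. R `` {f a b})"
    by (intro congruent2I' equiv_class_eq[OF R] cong)
  show m: "(R `` {a}) \<otimes>\<^bsub>M\<^esub> (R `` {b}) = R `` {f a b}" if "a \<in> X" "b \<in> X" for a b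
    using UN_equiv_class2[OF R R c2 that] by (simp add: M_def)
  have car: "carrier M = X // R" and one: "\<one>\<^bsub>M\<^esub> = R `` {e}"
    by (simp_all add: M_def)
  show "group M"
  proof (rule groupI)
    fix x y z assume "x \<in> carrier M" "y \<in> carrier M" "z \<in> carrier M"
    then obtain a b c where abc: "a \<in> X" "b \<in> X" "c \<in> X"
      "x = R `` {a}" "y = R `` {b}" "z = R `` {c}"
      by (auto simp: car elim!: quotientE)
    show "x \<otimes>\<^bsub>M\<^esub> y \<otimes>\<^bsub>M\<^esub> z = x \<otimes>\<^bsub>M\<^esub> (y \<otimes>\<^bsub>M\<^esub> z)"
      using abc by (simp add: m cl equiv_class_eq[OF R assoc])
  next
    fix x y assume "x \<in> carrier M" "y \<in> carrier M"
    then show "x \<otimes>\<^bsub>M\<^esub> y \<in> carrier M"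
      by (auto simp: car m cl elim!: quotientE intro!: quotientI)
  next
    show "\<one>\<^bsub>M\<^esub> \<in> carrier M"
      using e by (auto simp: car one intro: quotientI)
  next
    fix x assume "x \<in> carrier M"
    then obtain a where a: "a \<in> X" "x = R `` {a}"
      by (auto simp: car elim!: quotientE)
    show "\<one>\<^bsub>M\<^esub> \<otimes>\<^bsub>M\<^esub> x = x"
      using a e by (simp add: one m equiv_class_eq[OF R])
    obtain b where b: "b \<in> X" "(f b a, e) \<in> R"
      using inv a by blast
    show "\<exists>y\<in>carrier M. y \<otimes>\<^bsub>M\<^esub> x = \<one>\<^bsub>M\<^esub>"
      using a b by (intro bexI[of _ "R `` {b}"])
        (simp_all add: one m car equiv_class_eq[OF R] quotientI)
  qed
qed

section \<open>Commensurations of a group\<close>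

context group
begin

section \<open>Subgroups of finite index\<close>

text \<open>Finite index is used below in the form G = H T with T finite. Since T may meet a coset
  more than once, images and products of such sets can serve directly as new ones.\<close>

lemma finite_index_subgroupI:
  assumes "subgroup H G" "finite T" "T \<subseteq> carrier G"
    and "\<And>g. g \<in> carrier G \<Longrightarrow> \<exists>h\<in>H. \<exists>t\<in>T. g = h \<otimes> t"
  shows "finite_index_subgroup H G"
proof -
  have "rcosets H \<subseteq> (\<lambda>t. H #> t) ` T"
  proof
    fix U assume "U \<in> rcosets H"
    then obtain g where g: "g \<in> carrier G" "U = H #> g"
      by (auto simp: RCOSETS_def)
    then obtain h t where ht: "h \<in> H" "t \<in> T" "g = h \<otimes> t"
      using assms(4) by blast
    then have "U = H #> t"
      using assms(1,3) coset_mult_assoc[of H h t] coset_join2[of h H] g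
      by (simp add: subgroup.mem_carrier subgroup.subset subset_iff)
    then show "U \<in> (\<lambda>t. H #> t) ` T"
      using ht by blast
  qed
  then show ?thesis
    using assms(1,2) by (auto simp: finite_index_subgroup_def intro: finite_subset)
qed

lemma finite_index_subgroupE:
  assumes "finite_index_subgroup H G"
  obtains T where "finite T" "T \<subseteq> carrier G"
    "\<And>g. g \<in> carrier G \<Longrightarrow> \<exists>h\<in>H. \<exists>t\<in>T. g = h \<otimes> t"
proof -
  have H: "subgroup H G" and fin: "finite (rcosets H)"
    using assms by (auto simp: finite_index_subgroup_def)
  define rep where "rep U = (SOME t. t \<in> U)" for U :: "'a set"
  have rep: "rep (H #> g) \<in> H #> g" if "g \<in> carrier G" for g
    unfolding rep_def using rcos_self[OF that H] by (rule someI)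
  show thesis
  proof (rule that)
    show "finite (rep ` (rcosets H))"
      using fin by simp
    show "rep ` (rcosets H) \<subseteq> carrier G"
      using rep r_coset_subset_G[OF subgroup.subset[OF H]] by (auto simp: RCOSETS_def)
    fix g assume g: "g \<in> carrier G"
    then obtain h where h: "h \<in> H" "rep (H #> g) = h \<otimes> g"
      using rep[OF g] by (auto simp: r_coset_def)
    then have "g = inv h \<otimes> rep (H #> g)"
      using g H by (simp add: subgroup.mem_carrier m_assoc[symmetric])
    moreover have "inv h \<in> H" "H #> g \<in> rcosets H"
      using h g H by (auto simp: RCOSETS_def subgroup.m_inv_closed)
    ultimately show "\<exists>h\<in>H. \<exists>t\<in>rep ` (rcosets H). g = h \<otimes> t"
      by blast
  qed
qed

lemma finite_index_subgroup_carrier: "finite_index_subgroup (carrier G) G"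
  by (rule finite_index_subgroupI[of _ "{\<one>}"]) (auto simp: subgroup_self intro: r_one[symmetric])

text \<open>A coset of the intersection is the intersection of a coset of H and a coset of K, so
  there are at most as many as pairs of cosets.\<close>

lemma finite_index_subgroup_Int:
  assumes "finite_index_subgroup H G" "finite_index_subgroup K G"
  shows "finite_index_subgroup (H \<inter> K) G"
proof -
  have H: "subgroup H G" and K: "subgroup K G"
    using assms by (auto simp: finite_index_subgroup_def)
  have int: "(H \<inter> K) #> g = (H #> g) \<inter> (K #> g)" if "g \<in> carrier G" for g
  proof
    show "(H #> g) \<inter> (K #> g) \<subseteq> (H \<inter> K) #> g"
    proof
      fix x assume "x \<in> (H #> g) \<inter> (K #> g)"
      then obtain h k where hk: "h \<in> H" "k \<in> K" "x = h \<otimes> g" "x = k \<otimes> g"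
        by (auto simp: r_coset_def)
      then have "h = k"
        using that subgroup.mem_carrier[OF H hk(1)] subgroup.mem_carrier[OF K hk(2)]
        by (metis right_cancel)
      then show "x \<in> (H \<inter> K) #> g"
        using hk by (auto simp: r_coset_def)
    qed
  qed (auto simp: r_coset_def)
  have "rcosets (H \<inter> K) \<subseteq> (\<lambda>(U, V). U \<inter> V) ` ((rcosets H) \<times> (rcosets K))"
  proof
    fix U assume "U \<in> rcosets (H \<inter> K)"
    then obtain g where g: "g \<in> carrier G" "U = (H #> g) \<inter> (K #> g)"
      using int by (auto simp: RCOSETS_def)
    then have "(H #> g, K #> g) \<in> (rcosets H) \<times> (rcosets K)"
      by (auto simp: RCOSETS_def)
    then show "U \<in> (\<lambda>(U, V). U \<inter> V) ` ((rcosets H) \<times> (rcosets K))"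
      using g(2) by (intro image_eqI[of _ _ "(H #> g, K #> g)"]) auto
  qed
  then show ?thesis
    using assms subgroups_Inter_pair[OF H K]
    by (auto simp: finite_index_subgroup_def intro: finite_subset)
qed

text \<open>From K = H T and G = K V follows G = H (T V). Expressing the index of H in K by a finite
  set T avoids passing to the group with carrier K.\<close>

lemma finite_index_subgroup_trans:
  assumes "subgroup H G" "finite_index_subgroup K G" "finite T" "T \<subseteq> carrier G" "H \<subseteq> K"
    and T: "\<And>g. g \<in> K \<Longrightarrow> \<exists>h\<in>H. \<exists>t\<in>T. g = h \<otimes> t"
  shows "finite_index_subgroup H G"
proof -
  obtain V where V: "finite V" "V \<subseteq> carrier G"
    "\<And>g. g \<in> carrier G \<Longrightarrow> \<exists>h\<in>K. \<exists>t\<in>V. g = h \<otimes> t"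
    using finite_index_subgroupE[OF assms(2)] by blast
  show ?thesis
  proof (rule finite_index_subgroupI[of _ "(\<lambda>(t, v). t \<otimes> v) ` (T \<times> V)"])
    fix g assume "g \<in> carrier G"
    then obtain k v where kv: "k \<in> K" "v \<in> V" "g = k \<otimes> v"
      using V(3) by blast
    then obtain h t where ht: "h \<in> H" "t \<in> T" "k = h \<otimes> t"
      using T by blast
    have "g = h \<otimes> (t \<otimes> v)"
      using kv ht V(2) assms(1,4) m_assoc[of h t v] by (auto simp: subgroup.mem_carrier)
    then show "\<exists>h\<in>H. \<exists>t\<in>(\<lambda>(t, v). t \<otimes> v) ` (T \<times> V). g = h \<otimes> t"
      using kv ht by blast
  qed (use assms V in auto)
qed

section \<open>Commensurations, their inverses and composites\<close>

lemma commensurations_iff: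
  "(A, B, \<alpha>) \<in> commensurations G \<longleftrightarrow>
     finite_index_subgroup A G \<and> finite_index_subgroup B G \<and> bij_betw \<alpha> A B \<and>
     (\<forall>x\<in>A. \<forall>y\<in>A. \<alpha> (x \<otimes> y) = \<alpha> x \<otimes> \<alpha> y) \<and> \<alpha> \<in> extensional A"
  by (auto simp: commensurations_def iso_def hom_def bij_betw_def)

lemma commensurationsD:
  assumes "(A, B, \<alpha>) \<in> commensurations G"
  shows "finite_index_subgroup A G" "finite_index_subgroup B G" "bij_betw \<alpha> A B"
    "\<And>x y. x \<in> A \<Longrightarrow> y \<in> A \<Longrightarrow> \<alpha> (x \<otimes> y) = \<alpha> x \<otimes> \<alpha> y" "\<alpha> \<in> extensional A"
    "subgroup A G" "subgroup B G" "\<And>x. x \<in> A \<Longrightarrow> \<alpha> x \<in> B"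
    "\<And>x. x \<in> A \<Longrightarrow> x \<in> carrier G" "\<And>x. x \<in> A \<Longrightarrow> \<alpha> x \<in> carrier G"
  using assms
  by (auto simp: commensurations_iff finite_index_subgroup_def bij_betw_def subgroup.mem_carrier
      intro: subgroup.mem_carrier)

lemma commensuration_group_hom:
  assumes "(A, B, \<alpha>) \<in> commensurations G"
  shows "group_hom (G\<lparr>carrier := A\<rparr>) G \<alpha>"
proof -
  have "group (G\<lparr>carrier := A\<rparr>)"
    using commensurationsD(6)[OF assms] by (rule subgroup_imp_group)
  then show ?thesis
    using commensurationsD[OF assms]
    by (auto simp: group_hom_def group_hom_axioms_def hom_def is_group)
qed

lemma commensuration_inv:
  assumes "(A, B, \<alpha>) \<in> commensurations G" "x \<in> A"
  shows "\<alpha> (inv x) = inv (\<alpha> x)"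
  using group_hom.hom_inv[OF commensuration_group_hom[OF assms(1)]] assms(2)
    m_inv_consistent[OF commensurationsD(6)[OF assms(1)]] by simp

lemma commensuration_inverse:
  assumes "(A, B, \<alpha>) \<in> commensurations G"
  shows "(B, A, restrict (inv_into A \<alpha>) B) \<in> commensurations G"
proof -
  note D = commensurationsD[OF assms]
  have "inv_into A \<alpha> (x \<otimes> y) = inv_into A \<alpha> x \<otimes> inv_into A \<alpha> y" if xy: "x \<in> B" "y \<in> B" for x y
  proof -
    obtain a b where ab: "a \<in> A" "b \<in> A" "x = \<alpha> a" "y = \<alpha> b"
      using xy bij_betw_imp_surj_on[OF D(3)] by blast
    then have "x \<otimes> y = \<alpha> (a \<otimes> b)" "a \<otimes> b \<in> A"
      using D by (simp_all add: subgroup.m_closed)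
    then show ?thesis
      using ab D(3) by (simp add: bij_betw_def)
  qed
  then show ?thesis
    using D by (simp add: commensurations_iff subgroup.m_closed bij_betw_inv_into)
qed

text \<open>If G = H T, then A = H (T \<inter> A), because h and h t in A force t into A. Applying
  \<alpha> gives B = \<alpha>(H) \<alpha>(T \<inter> A), and B has finite index.\<close>

lemma finite_index_subgroup_image:
  assumes "(A, B, \<alpha>) \<in> commensurations G" "finite_index_subgroup H G" "H \<subseteq> A"
  shows "finite_index_subgroup (\<alpha> ` H) G"
proof -
  note D = commensurationsD[OF assms(1)]
  have H: "subgroup H G"
    using assms(2) by (simp add: finite_index_subgroup_def)
  obtain T where T: "finite T" "T \<subseteq> carrier G"
    "\<And>g. g \<in> carrier G \<Longrightarrow> \<exists>h\<in>H. \<exists>t\<in>T. g = h \<otimes> t"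
    using finite_index_subgroupE[OF assms(2)] by blast
  have "subgroup H (G\<lparr>carrier := A\<rparr>)"
    using subgroup_incl[OF H D(6) assms(3)] .
  then have sub: "subgroup (\<alpha> ` H) G"
    using group_hom.subgroup_img_is_subgroup[OF commensuration_group_hom[OF assms(1)]] by blast
  show ?thesis
  proof (rule finite_index_subgroup_trans[of _ B "\<alpha> ` (T \<inter> A)"])
    fix b assume "b \<in> B"
    then obtain a where a: "a \<in> A" "b = \<alpha> a"
      using D(3) by (auto simp: bij_betw_def)
    then obtain h t where ht: "h \<in> H" "t \<in> T" "a = h \<otimes> t"
      using T(3) D by blast
    have "t = inv h \<otimes> a"
      using ht T(2) H by (auto simp: subgroup.mem_carrier m_assoc[symmetric])
    then have tA: "t \<in> A"
      using ht(1) a(1) assms(3) D(6) by (auto simp: subgroup.m_closed subgroup.m_inv_closed)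
    then have "b = \<alpha> h \<otimes> \<alpha> t"
      using a ht assms(3) D(4) by auto
    then show "\<exists>h\<in>\<alpha> ` H. \<exists>t\<in>\<alpha> ` (T \<inter> A). b = h \<otimes> t"
      using ht tA by blast
  qed (use sub D T assms in auto)
qed

text \<open>The preimage of L under \<alpha> is the image of B \<inter> L under the inverse
  commensuration, so the result on images applies.\<close>

lemma finite_index_subgroup_vimage:
  assumes "(A, B, \<alpha>) \<in> commensurations G" "finite_index_subgroup L G"
  shows "finite_index_subgroup {x \<in> A. \<alpha> x \<in> L} G"
proof -
  note D = commensurationsD[OF assms(1)]
  have "finite_index_subgroup (restrict (inv_into A \<alpha>) B ` (B \<inter> L)) G"
    using D(2) assms
    by (intro finite_index_subgroup_image[OF commensuration_inverse] finite_index_subgroup_Int) auto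
  moreover have "restrict (inv_into A \<alpha>) B ` (B \<inter> L) = {x \<in> A. \<alpha> x \<in> L}"
    using D(3) by (force simp: bij_betw_def)
  ultimately show ?thesis by simp
qed

lemma com_comp_closed:
  assumes b: "b \<in> commensurations G" and a: "a \<in> commensurations G"
  shows "com_comp b a \<in> commensurations G"
proof -
  obtain A B \<alpha> C D \<beta> where eq: "a = (A, B, \<alpha>)" "b = (C, D, \<beta>)"
    by (metis prod_cases3)
  note A = commensurationsD[OF a[unfolded eq]] and C = commensurationsD[OF b[unfolded eq]]
  define E where "E = {x \<in> A. \<alpha> x \<in> B \<inter> C}"
  have BC: "finite_index_subgroup (B \<inter> C) G"
    using A(2) C(1) by (rule finite_index_subgroup_Int)
  have E: "finite_index_subgroup E G"
    unfolding E_def using finite_index_subgroup_vimage[OF a[unfolded eq] BC] .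
  have im: "finite_index_subgroup (\<beta> ` (B \<inter> C)) G"
    using finite_index_subgroup_image[OF b[unfolded eq] BC] by simp
  have "bij_betw \<alpha> E (B \<inter> C)"
    using A(3) unfolding bij_betw_def E_def by (auto simp: inj_on_def)
  moreover have "bij_betw \<beta> (B \<inter> C) (\<beta> ` (B \<inter> C))"
    using C(3) unfolding bij_betw_def by (auto simp: inj_on_def)
  ultimately have "bij_betw (compose E \<beta> \<alpha>) E (\<beta> ` (B \<inter> C))"
    by (rule bij_betw_compose)
  moreover have "compose E \<beta> \<alpha> (x \<otimes> y) = compose E \<beta> \<alpha> x \<otimes> compose E \<beta> \<alpha> y"
    if xy: "x \<in> E" "y \<in> E" for x y
  proof -
    have "x \<otimes> y \<in> E"
      using xy E by (simp add: finite_index_subgroup_def subgroup.m_closed)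
    then show ?thesis
      using xy A(4) C(4) by (simp add: compose_eq E_def)
  qed
  ultimately have "(E, \<beta> ` (B \<inter> C), compose E \<beta> \<alpha>) \<in> commensurations G"
    using E im by (simp add: commensurations_iff)
  then show ?thesis
    by (simp add: eq E_def Let_def)
qed

section \<open>The group Com(G)\<close>

lemma com_equivI:
  assumes "(A, B, \<alpha>) \<in> commensurations G" "(C, D, \<beta>) \<in> commensurations G"
    "finite_index_subgroup H G" "H \<subseteq> A" "H \<subseteq> C" "\<And>x. x \<in> H \<Longrightarrow> \<alpha> x = \<beta> x"
  shows "((A, B, \<alpha>), (C, D, \<beta>)) \<in> com_equiv G"
  using assms by (auto simp: com_equiv_def)

lemma com_equivE:
  assumes "((A, B, \<alpha>), (C, D, \<beta>)) \<in> com_equiv G"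
  obtains H where "(A, B, \<alpha>) \<in> commensurations G" "(C, D, \<beta>) \<in> commensurations G"
    "finite_index_subgroup H G" "H \<subseteq> A" "H \<subseteq> C" "\<And>x. x \<in> H \<Longrightarrow> \<alpha> x = \<beta> x"
  using assms by (auto simp: com_equiv_def)

lemma equiv_com_equiv: "equiv (commensurations G) (com_equiv G)"
proof (rule equivI)
  show "com_equiv G \<subseteq> commensurations G \<times> commensurations G"
    by (auto simp: com_equiv_def)
  show "refl_on (commensurations G) (com_equiv G)"
    by (rule refl_onI) (auto simp: com_equiv_def commensurations_def)
  show "sym (com_equiv G)"
    by (rule symI) (fastforce simp: com_equiv_def)
  show "trans (com_equiv G)"
  proof (rule transI)
    fix a b c assume ab: "(a, b) \<in> com_equiv G" and bc: "(b, c) \<in> com_equiv G"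
    obtain A A' \<alpha> B B' \<beta> C C' \<gamma> where eq: "a = (A, A', \<alpha>)" "b = (B, B', \<beta>)" "c = (C, C', \<gamma>)"
      by (metis prod_cases3)
    obtain H where H: "(A, A', \<alpha>) \<in> commensurations G" "finite_index_subgroup H G"
      "H \<subseteq> A" "\<And>x. x \<in> H \<Longrightarrow> \<alpha> x = \<beta> x"
      using ab unfolding eq by (elim com_equivE) blast
    obtain L where L: "(C, C', \<gamma>) \<in> commensurations G" "finite_index_subgroup L G"
      "L \<subseteq> C" "\<And>x. x \<in> L \<Longrightarrow> \<beta> x = \<gamma> x"
      using bc unfolding eq by (elim com_equivE) blast
    show "(a, c) \<in> com_equiv G"
      unfolding eq using H L
      by (intro com_equivI[OF H(1) L(1) finite_index_subgroup_Int[OF H(2) L(2)]]) auto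
  qed
qed

lemma com_comp_cong:
  assumes "(b, b') \<in> com_equiv G" "(a, a') \<in> com_equiv G"
  shows "(com_comp b a, com_comp b' a') \<in> com_equiv G"
proof -
  obtain A B \<alpha> C D \<beta> A' B' \<alpha>' C' D' \<beta>'
    where eq: "a = (A, B, \<alpha>)" "b = (C, D, \<beta>)" "a' = (A', B', \<alpha>')" "b' = (C', D', \<beta>')"
    by (metis prod_cases3)
  from assms(2) obtain H where H: "(A, B, \<alpha>) \<in> commensurations G" "(A', B', \<alpha>') \<in> commensurations G"
    "finite_index_subgroup H G" "H \<subseteq> A" "H \<subseteq> A'" "\<And>x. x \<in> H \<Longrightarrow> \<alpha> x = \<alpha>' x"
    unfolding eq by (elim com_equivE) blast
  from assms(1) obtain L where L: "(C, D, \<beta>) \<in> commensurations G" "(C', D', \<beta>') \<in> commensurations G"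
    "finite_index_subgroup L G" "L \<subseteq> C" "L \<subseteq> C'" "\<And>x. x \<in> L \<Longrightarrow> \<beta> x = \<beta>' x"
    unfolding eq by (elim com_equivE) blast
  \<comment> \<open>On K the maps \<alpha> and \<alpha>' agree, and their common value lies in L,
    where \<beta> and \<beta>' agree.\<close>
  define K where "K = H \<inter> {x \<in> A. \<alpha> x \<in> L}"
  have K: "finite_index_subgroup K G"
    unfolding K_def using H L by (intro finite_index_subgroup_Int finite_index_subgroup_vimage)
  have dom: "K \<subseteq> {x \<in> A. \<alpha> x \<in> B \<inter> C}" "K \<subseteq> {x \<in> A'. \<alpha>' x \<in> B' \<inter> C'}"
    using H L commensurationsD(8)[OF H(1)] commensurationsD(8)[OF H(2)] unfolding K_def by fastforce+
  moreover have "\<alpha> x = \<alpha>' x" "\<beta> (\<alpha>' x) = \<beta>' (\<alpha>' x)" if "x \<in> K" for x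
    using that H(6) L(6) by (auto simp: K_def)
  ultimately show ?thesis
    using com_comp_closed[OF L(1) H(1)] com_comp_closed[OF L(2) H(2)]
    unfolding eq com_comp.simps Let_def
    by (intro com_equivI[OF _ _ K]) (auto simp: compose_def)
qed

lemma com_comp_assoc:
  assumes "a \<in> commensurations G" "b \<in> commensurations G" "c \<in> commensurations G"
  shows "(com_comp (com_comp a b) c, com_comp a (com_comp b c)) \<in> com_equiv G"
proof -
  obtain A A' \<alpha> B B' \<beta> C C' \<gamma> where eq: "a = (A, A', \<alpha>)" "b = (B, B', \<beta>)" "c = (C, C', \<gamma>)"
    by (metis prod_cases3)
  obtain X Y \<phi> Z W \<psi> where e: "com_comp (com_comp a b) c = (X, Y, \<phi>)"
      "com_comp a (com_comp b c) = (Z, W, \<psi>)"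
    by (metis prod_cases3)
  have m: "(X, Y, \<phi>) \<in> commensurations G" "(Z, W, \<psi>) \<in> commensurations G"
    using assms by (metis e com_comp_closed)+
  \<comment> \<open>As the domain of a commensuration, X has finite index, so it can itself witness
    the equivalence.\<close>
  have X: "X \<subseteq> Z" "\<And>x. x \<in> X \<Longrightarrow> \<phi> x = \<psi> x"
    using e unfolding eq com_comp.simps Let_def by (auto simp: compose_def)
  show ?thesis
    unfolding e using m X by (intro com_equivI[OF m commensurationsD(1)[OF m(1)]]) auto
qed

lemma com_identity: "(carrier G, carrier G, \<lambda>x\<in>carrier G. x) \<in> commensurations G"
  by (simp add: commensurations_iff finite_index_subgroup_carrier bij_betw_def inj_on_def)

lemma com_comp_identity:
  assumes "a \<in> commensurations G"
  shows "(com_comp (carrier G, carrier G, \<lambda>x\<in>carrier G. x) a, a) \<in> com_equiv G"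
proof -
  obtain A B \<alpha> where eq: "a = (A, B, \<alpha>)"
    by (metis prod_cases3)
  note A = commensurationsD[OF assms[unfolded eq]]
  show ?thesis
    using com_comp_closed[OF com_identity assms] assms A
    unfolding eq com_comp.simps Let_def
    by (intro com_equivI[OF _ _ A(1)]) (auto simp: compose_def)
qed

lemma com_comp_inverse:
  assumes "a \<in> commensurations G"
  shows "\<exists>b\<in>commensurations G. (com_comp b a, (carrier G, carrier G, \<lambda>x\<in>carrier G. x)) \<in> com_equiv G"
proof -
  obtain A B \<alpha> where eq: "a = (A, B, \<alpha>)"
    by (metis prod_cases3)
  note A = commensurationsD[OF assms[unfolded eq]]
  have b: "(B, A, restrict (inv_into A \<alpha>) B) \<in> commensurations G"
    using assms unfolding eq by (rule commensuration_inverse)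
  show ?thesis
    using com_comp_closed[OF b assms] com_identity assms A
    unfolding eq com_comp.simps Let_def
    by (intro bexI[OF _ b]) (auto intro!: com_equivI[OF _ _ A(1)] simp: compose_def bij_betw_def)
qed

lemma group_Com: "group (Com G)"
  unfolding Com_def
  by (rule quotient_group_is_group[OF equiv_com_equiv com_comp_closed com_comp_cong com_comp_assoc
        com_identity com_comp_identity com_comp_inverse])

lemma Com_mult:
  assumes "a \<in> commensurations G" "b \<in> commensurations G"
  shows "(com_equiv G `` {a}) \<otimes>\<^bsub>Com G\<^esub> (com_equiv G `` {b}) = com_equiv G `` {com_comp a b}"
  unfolding Com_def
  by (rule quotient_group_mult[OF equiv_com_equiv com_comp_closed com_comp_cong com_comp_assoc
        com_identity com_comp_identity com_comp_inverse assms])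

end

section \<open>Quasi-isometries of a pseudometric space\<close>

text \<open>The word metric enters the construction of QI(G) only through these properties.\<close>

locale pseudometric_on =
  fixes X :: "'a set" and d :: "'a \<Rightarrow> 'a \<Rightarrow> real"
  assumes nonneg: "x \<in> X \<Longrightarrow> y \<in> X \<Longrightarrow> d x y \<ge> 0"
    and refl: "x \<in> X \<Longrightarrow> d x x = 0"
    and sym: "x \<in> X \<Longrightarrow> y \<in> X \<Longrightarrow> d x y = d y x"
    and triangle: "x \<in> X \<Longrightarrow> y \<in> X \<Longrightarrow> z \<in> X \<Longrightarrow> d x z \<le> d x y + d y z"
begin

text \<open>The lower bound is multiplied out by K, which keeps the estimates below free of
  division.\<close>

lemma quasi_isometriesI:
  assumes "f \<in> X \<rightarrow>\<^sub>E X" "K \<ge> 1" "C \<ge> 0"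
    and "\<And>x y. x \<in> X \<Longrightarrow> y \<in> X \<Longrightarrow> d (f x) (f y) \<le> K * d x y + C"
    and "\<And>x y. x \<in> X \<Longrightarrow> y \<in> X \<Longrightarrow> d x y \<le> K * (d (f x) (f y) + C)"
    and "\<And>y. y \<in> X \<Longrightarrow> \<exists>x\<in>X. d (f x) y \<le> C"
  shows "f \<in> quasi_isometries X d"
proof -
  have "d x y / K - C \<le> d (f x) (f y)" if "x \<in> X" "y \<in> X" for x y
    using assms(5)[OF that] assms(2) by (simp add: field_simps)
  then show ?thesis
    unfolding quasi_isometries_def using assms(1-4,6)
    by (intro CollectI conjI exI[of _ K] exI[of _ C] ballI) auto
qed

lemma quasi_isometriesE:
  assumes "f \<in> quasi_isometries X d"
  obtains K C where "f \<in> X \<rightarrow>\<^sub>E X" "\<And>x. x \<in> X \<Longrightarrow> f x \<in> X" "K \<ge> 1" "C \<ge> 0"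
    "\<And>x y. x \<in> X \<Longrightarrow> y \<in> X \<Longrightarrow> d (f x) (f y) \<le> K * d x y + C"
    "\<And>x y. x \<in> X \<Longrightarrow> y \<in> X \<Longrightarrow> d x y \<le> K * (d (f x) (f y) + C)"
    "\<And>y. y \<in> X \<Longrightarrow> \<exists>x\<in>X. d (f x) y \<le> C"
proof -
  obtain K C where KC: "f \<in> X \<rightarrow>\<^sub>E X" "K \<ge> 1" "C \<ge> 0"
    "\<And>x y. x \<in> X \<Longrightarrow> y \<in> X \<Longrightarrow> d (f x) (f y) \<le> K * d x y + C"
    "\<And>x y. x \<in> X \<Longrightarrow> y \<in> X \<Longrightarrow> d x y / K - C \<le> d (f x) (f y)"
    "\<And>y. y \<in> X \<Longrightarrow> \<exists>x\<in>X. d (f x) y \<le> C"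
    using assms unfolding quasi_isometries_def by blast
  have "d x y \<le> K * (d (f x) (f y) + C)" if "x \<in> X" "y \<in> X" for x y
    using KC(5)[OF that] KC(2) by (simp add: field_simps)
  with KC show thesis
    by (intro that[of K C]) auto
qed

lemma qi_equivI:
  assumes "f \<in> quasi_isometries X d" "g \<in> quasi_isometries X d" "\<And>t. t \<in> X \<Longrightarrow> d (f t) (g t) \<le> M"
  shows "(f, g) \<in> qi_equiv X d"
proof -
  \<comment> \<open>\<open>qi_equiv\<close> wants a positive bound, while the bounds produced by the
    estimates are arbitrary reals.\<close>
  have "\<forall>t\<in>X. d (f t) (g t) \<le> max M 1" "max M 1 > 0"
    using assms(3) by (auto intro: max.coboundedI1)
  then show ?thesis
    using assms(1,2) unfolding qi_equiv_def by blast
qed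

lemma qi_equivE:
  assumes "(f, g) \<in> qi_equiv X d"
  obtains M where "f \<in> quasi_isometries X d" "g \<in> quasi_isometries X d"
    "\<And>t. t \<in> X \<Longrightarrow> f t \<in> X" "\<And>t. t \<in> X \<Longrightarrow> g t \<in> X"
    "\<And>t. t \<in> X \<Longrightarrow> d (f t) (g t) \<le> M"
proof -
  obtain M where "f \<in> quasi_isometries X d" "g \<in> quasi_isometries X d"
    "\<forall>t\<in>X. d (f t) (g t) \<le> M"
    using assms unfolding qi_equiv_def by blast
  then show thesis
    by (intro that[of M]) (auto simp: quasi_isometries_def)
qed

lemma equiv_qi_equiv: "equiv (quasi_isometries X d) (qi_equiv X d)"
proof (rule equivI)
  show "qi_equiv X d \<subseteq> quasi_isometries X d \<times> quasi_isometries X d"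
    by (auto simp: qi_equiv_def)
  show "refl_on (quasi_isometries X d) (qi_equiv X d)"
  proof (rule refl_onI)
    fix f assume f: "f \<in> quasi_isometries X d"
    then have "d (f t) (f t) \<le> 0" if "t \<in> X" for t
      using that by (subst refl) (auto simp: quasi_isometries_def)
    then show "(f, f) \<in> qi_equiv X d"
      by (rule qi_equivI[OF f f])
  qed
  show "sym (qi_equiv X d)"
  proof (rule symI)
    fix f g assume "(f, g) \<in> qi_equiv X d"
    then obtain M where M: "f \<in> quasi_isometries X d" "g \<in> quasi_isometries X d"
      "\<And>t. t \<in> X \<Longrightarrow> f t \<in> X" "\<And>t. t \<in> X \<Longrightarrow> g t \<in> X"
      "\<And>t. t \<in> X \<Longrightarrow> d (f t) (g t) \<le> M"
      by (rule qi_equivE) blast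
    have "d (g t) (f t) \<le> M" if "t \<in> X" for t
      using M(5)[OF that] sym[OF M(3)[OF that] M(4)[OF that]] by simp
    then show "(g, f) \<in> qi_equiv X d"
      by (rule qi_equivI[OF M(2,1)])
  qed
  show "trans (qi_equiv X d)"
  proof (rule transI)
    fix f g h assume fg: "(f, g) \<in> qi_equiv X d" and gh: "(g, h) \<in> qi_equiv X d"
    obtain M where M: "f \<in> quasi_isometries X d" "\<And>t. t \<in> X \<Longrightarrow> f t \<in> X"
      "\<And>t. t \<in> X \<Longrightarrow> g t \<in> X" "\<And>t. t \<in> X \<Longrightarrow> d (f t) (g t) \<le> M"
      by (rule qi_equivE[OF fg]) blast
    obtain N where N: "h \<in> quasi_isometries X d" "\<And>t. t \<in> X \<Longrightarrow> h t \<in> X"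
      "\<And>t. t \<in> X \<Longrightarrow> d (g t) (h t) \<le> N"
      by (rule qi_equivE[OF gh]) blast
    have "d (f t) (h t) \<le> M + N" if "t \<in> X" for t
      using triangle[of "f t" "g t" "h t"] M(2-4)[OF that] N(2,3)[OF that] by simp
    then show "(f, h) \<in> qi_equiv X d"
      by (rule qi_equivI[OF M(1) N(1)])
  qed
qed

section \<open>Composition and quasi-inverses\<close>

lemma compose_quasi_isometry:
  assumes f: "f \<in> quasi_isometries X d" and g: "g \<in> quasi_isometries X d"
  shows "compose X f g \<in> quasi_isometries X d"
proof -
  obtain K C where F: "f \<in> X \<rightarrow>\<^sub>E X" "\<And>x. x \<in> X \<Longrightarrow> f x \<in> X" "K \<ge> 1" "C \<ge> 0"
    "\<And>x y. x \<in> X \<Longrightarrow> y \<in> X \<Longrightarrow> d (f x) (f y) \<le> K * d x y + C"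
    "\<And>x y. x \<in> X \<Longrightarrow> y \<in> X \<Longrightarrow> d x y \<le> K * (d (f x) (f y) + C)"
    "\<And>y. y \<in> X \<Longrightarrow> \<exists>x\<in>X. d (f x) y \<le> C"
    by (rule quasi_isometriesE[OF f]) blast
  obtain L D where G: "g \<in> X \<rightarrow>\<^sub>E X" "\<And>x. x \<in> X \<Longrightarrow> g x \<in> X" "L \<ge> 1" "D \<ge> 0"
    "\<And>x y. x \<in> X \<Longrightarrow> y \<in> X \<Longrightarrow> d (g x) (g y) \<le> L * d x y + D"
    "\<And>x y. x \<in> X \<Longrightarrow> y \<in> X \<Longrightarrow> d x y \<le> L * (d (g x) (g y) + D)"
    "\<And>y. y \<in> X \<Longrightarrow> \<exists>x\<in>X. d (g x) y \<le> D"
    by (rule quasi_isometriesE[OF g]) blast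
  \<comment> \<open>The upper bound needs K D + C, the lower bound C + D, and coarse surjectivity K
    D + 2 C. The sum E covers all three.\<close>
  define E where "E = K * D + 2 * C + D"
  have KD: "D \<le> K * D" "0 \<le> K * D"
    using F(3) G(4) mult_right_mono[of 1 K D] by simp_all
  have KC: "K * C \<ge> 0"
    using F(3,4) by simp
  show ?thesis
  proof (rule quasi_isometriesI[of _ "K * L" E])
    show "compose X f g \<in> X \<rightarrow>\<^sub>E X"
      using F(2) G(2) by (auto simp: compose_def)
    show "K * L \<ge> 1"
      using F(3) G(3) mult_mono[of 1 K 1 L] by simp
    show "E \<ge> 0"
      using KD F(4) G(4) by (simp add: E_def)
  next
    fix x y assume xy: "x \<in> X" "y \<in> X"
    have "d (f (g x)) (f (g y)) \<le> K * (L * d x y + D) + C"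
      using F(5)[OF G(2)[OF xy(1)] G(2)[OF xy(2)]] mult_left_mono[OF G(5)[OF xy], of K] F(3) by linarith
    also have "\<dots> \<le> K * L * d x y + E"
      using F(4) G(4) by (simp add: E_def algebra_simps)
    finally show "d (compose X f g x) (compose X f g y) \<le> K * L * d x y + E"
      using xy by (simp add: compose_eq)
    have "d (g x) (g y) + D \<le> K * (d (f (g x)) (f (g y)) + C) + D"
      using F(6)[OF G(2)[OF xy(1)] G(2)[OF xy(2)]] by simp
    also have "\<dots> \<le> K * (d (f (g x)) (f (g y)) + (C + D))"
      using KD by (simp add: algebra_simps)
    also have "\<dots> \<le> K * (d (f (g x)) (f (g y)) + E)"
      using F(3,4) KD by (intro mult_left_mono) (simp_all add: E_def)
    finally have "L * (d (g x) (g y) + D) \<le> L * (K * (d (f (g x)) (f (g y)) + E))"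
      using G(3) by (intro mult_left_mono) auto
    then have "d x y \<le> L * (K * (d (f (g x)) (f (g y)) + E))"
      using G(6)[OF xy] by linarith
    then show "d x y \<le> K * L * (d (compose X f g x) (compose X f g y) + E)"
      using xy by (simp add: compose_eq mult_ac)
  next
    fix y assume y: "y \<in> X"
    obtain u where u: "u \<in> X" "d (f u) y \<le> C"
      using F(7)[OF y] by blast
    obtain x where x: "x \<in> X" "d (g x) u \<le> D"
      using G(7)[OF u(1)] by blast
    have "d (f (g x)) y \<le> d (f (g x)) (f u) + d (f u) y"
      using x u y F(2) G(2) by (intro triangle) auto
    also have "d (f (g x)) (f u) \<le> K * D + C"
      using F(5)[OF G(2)[OF x(1)] u(1)] mult_left_mono[OF x(2), of K] F(3) by linarith
    finally have "d (f (g x)) y \<le> E"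
      using u(2) G(4) by (simp add: E_def)
    then show "\<exists>x\<in>X. d (compose X f g x) y \<le> E"
      using x(1) by (auto simp: compose_eq)
  qed
qed

lemma compose_qi_equiv:
  assumes "(f, f') \<in> qi_equiv X d" "(g, g') \<in> qi_equiv X d"
  shows "(compose X f g, compose X f' g') \<in> qi_equiv X d"
proof -
  obtain M where F: "f \<in> quasi_isometries X d" "f' \<in> quasi_isometries X d"
    "\<And>t. t \<in> X \<Longrightarrow> f t \<in> X" "\<And>t. t \<in> X \<Longrightarrow> f' t \<in> X" "\<And>t. t \<in> X \<Longrightarrow> d (f t) (f' t) \<le> M"
    by (rule qi_equivE[OF assms(1)]) blast
  obtain N where G: "g \<in> quasi_isometries X d" "g' \<in> quasi_isometries X d"
    "\<And>t. t \<in> X \<Longrightarrow> g t \<in> X" "\<And>t. t \<in> X \<Longrightarrow> g' t \<in> X" "\<And>t. t \<in> X \<Longrightarrow> d (g t) (g' t) \<le> N"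
    by (rule qi_equivE[OF assms(2)]) blast
  obtain K C where K: "K \<ge> 1" "\<And>x y. x \<in> X \<Longrightarrow> y \<in> X \<Longrightarrow> d (f x) (f y) \<le> K * d x y + C"
    by (rule quasi_isometriesE[OF F(1)]) blast
  show ?thesis
  proof (rule qi_equivI)
    fix t assume t: "t \<in> X"
    \<comment> \<open>The intermediate point f(g' t) separates the two changes: the first summand is
      controlled by the upper bound for f, the second by the closeness of f and f'.\<close>
    have "d (f (g t)) (f' (g' t)) \<le> d (f (g t)) (f (g' t)) + d (f (g' t)) (f' (g' t))"
      using t F G by (intro triangle) auto
    also have "d (f (g t)) (f (g' t)) \<le> K * N + C"
      using K(2)[OF G(3,4)[OF t]] mult_left_mono[OF G(5)[OF t], of K] K(1) by linarith
    also have "d (f (g' t)) (f' (g' t)) \<le> M"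
      using F(5) G(4) t by blast
    finally show "d (compose X f g t) (compose X f' g' t) \<le> K * N + C + M"
      using t by (simp add: compose_eq)
  qed (use F G compose_quasi_isometry in auto)
qed

lemma compose_qi_assoc:
  assumes "f \<in> quasi_isometries X d" "g \<in> quasi_isometries X d" "h \<in> quasi_isometries X d"
  shows "(compose X (compose X f g) h, compose X f (compose X g h)) \<in> qi_equiv X d"
proof -
  have "compose X (compose X f g) h = compose X f (compose X g h)"
    using assms(3) by (intro compose_assoc[symmetric]) (auto simp: quasi_isometries_def)
  then show ?thesis
    using assms by (simp add: compose_quasi_isometry equiv_class_self[OF equiv_qi_equiv, simplified])
qed

lemma qi_identity: "(\<lambda>x\<in>X. x) \<in> quasi_isometries X d"
proof (rule quasi_isometriesI[of _ 1 0])
  fix y assume "y \<in> X"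
  then show "\<exists>x\<in>X. d ((\<lambda>x\<in>X. x) x) y \<le> 0"
    by (intro bexI[of _ y]) (simp_all add: refl)
qed auto

lemma compose_qi_identity:
  assumes "f \<in> quasi_isometries X d"
  shows "(compose X (\<lambda>x\<in>X. x) f, f) \<in> qi_equiv X d"
proof -
  have "compose X (\<lambda>x\<in>X. x) f = f"
    using assms by (intro Id_compose) (auto simp: quasi_isometries_def PiE_def)
  then show ?thesis
    using assms by (simp add: equiv_class_self[OF equiv_qi_equiv, simplified])
qed

text \<open>Coarse surjectivity of f lets g choose, for each y, a point that f sends within C of y.
  The lower bound for f turns closeness of images into closeness of points, which controls
  g.\<close>

lemma quasi_inverse:
  assumes f: "f \<in> quasi_isometries X d"
  shows "\<exists>g\<in>quasi_isometries X d. (compose X g f, \<lambda>x\<in>X. x) \<in> qi_equiv X d"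
proof -
  obtain K C where F: "f \<in> X \<rightarrow>\<^sub>E X" "\<And>x. x \<in> X \<Longrightarrow> f x \<in> X" "K \<ge> 1" "C \<ge> 0"
    "\<And>x y. x \<in> X \<Longrightarrow> y \<in> X \<Longrightarrow> d (f x) (f y) \<le> K * d x y + C"
    "\<And>x y. x \<in> X \<Longrightarrow> y \<in> X \<Longrightarrow> d x y \<le> K * (d (f x) (f y) + C)"
    "\<And>y. y \<in> X \<Longrightarrow> \<exists>x\<in>X. d (f x) y \<le> C"
    by (rule quasi_isometriesE[OF f]) blast
  obtain g0 where g0: "\<And>y. y \<in> X \<Longrightarrow> g0 y \<in> X \<and> d (f (g0 y)) y \<le> C"
    using F(7) by metis
  define g where "g = restrict g0 X"
  have g: "g \<in> X \<rightarrow>\<^sub>E X" "\<And>y. y \<in> X \<Longrightarrow> g y \<in> X" "\<And>y. y \<in> X \<Longrightarrow> d (f (g y)) y \<le> C"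
    using g0 by (auto simp: g_def)
  \<comment> \<open>The points g(f x) and x have images under f within C of each other.\<close>
  have gf: "d (g (f x)) x \<le> K * (2 * C)" if "x \<in> X" for x
  proof -
    have "d (g (f x)) x \<le> K * (d (f (g (f x))) (f x) + C)"
      using F(6) F(2) g(2) that by blast
    also have "\<dots> \<le> K * (C + C)"
      using F(2,3) g(3) that by (intro mult_left_mono) auto
    finally show ?thesis by simp
  qed
  have KC: "C \<le> K * C" "0 \<le> K * C"
    using F(3,4) mult_right_mono[of 1 K C] by simp_all
  have qg: "g \<in> quasi_isometries X d"
  \<comment> \<open>Replacing x and y by f(g x) and f(g y) costs C each, and the lower bound for f
    adds another C before multiplying by K. The remaining two requirements need only 3 C and 2 K
    C.\<close>
  proof (rule quasi_isometriesI[OF g(1) F(3), of "3 * (K * C)"])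
    fix x y assume xy: "x \<in> X" "y \<in> X"
    then have X: "g x \<in> X" "g y \<in> X" "f (g x) \<in> X" "f (g y) \<in> X"
      using g F by auto
    have b: "d (f (g x)) x \<le> C" "d (f (g y)) y \<le> C" "d x (f (g x)) \<le> C" "d y (f (g y)) \<le> C"
      using g(3) xy X sym by metis+
    have "d (f (g x)) (f (g y)) \<le> d (f (g x)) x + d x (f (g y))"
      "d x (f (g y)) \<le> d x y + d y (f (g y))"
      using xy X by (auto intro: triangle)
    then have "d (f (g x)) (f (g y)) + C \<le> d x y + 3 * C"
      using b by linarith
    then have "K * (d (f (g x)) (f (g y)) + C) \<le> K * (d x y + 3 * C)"
      using F(3) by (intro mult_left_mono) auto
    then show "d (g x) (g y) \<le> K * d x y + 3 * (K * C)"
      using F(6)[OF X(1,2)] by (simp add: algebra_simps)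
    have "d x y \<le> d x (f (g x)) + d (f (g x)) y" "d (f (g x)) y \<le> d (f (g x)) (f (g y)) + d (f (g y)) y"
      using xy X by (auto intro: triangle)
    then have "d x y \<le> K * d (g x) (g y) + 3 * C"
      using b F(5)[OF X(1,2)] by linarith
    also have "\<dots> \<le> K * (d (g x) (g y) + 3 * C)"
      using KC by (simp add: algebra_simps)
    also have "\<dots> \<le> K * (d (g x) (g y) + 3 * (K * C))"
      using F(3) KC by (intro mult_left_mono) auto
    finally show "d x y \<le> K * (d (g x) (g y) + 3 * (K * C))" .
  next
    fix x assume x: "x \<in> X"
    then show "\<exists>y\<in>X. d (g y) x \<le> 3 * (K * C)"
      using gf[OF x] F(2) KC by (intro bexI[of _ "f x"]) auto
  qed (use KC in auto)
  then show ?thesis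
    using gf by (intro bexI[OF _ qg] qi_equivI[OF compose_quasi_isometry[OF qg f] qi_identity])
      (auto simp: compose_eq)
qed

lemma group_QI_space: "group (QI_space X d)"
  unfolding QI_space_def
  by (rule quotient_group_is_group[OF equiv_qi_equiv compose_quasi_isometry compose_qi_equiv
        compose_qi_assoc qi_identity compose_qi_identity quasi_inverse])

lemma QI_space_mult:
  assumes "f \<in> quasi_isometries X d" "g \<in> quasi_isometries X d"
  shows "(qi_equiv X d `` {f}) \<otimes>\<^bsub>QI_space X d\<^esub> (qi_equiv X d `` {g}) = qi_equiv X d `` {compose X f g}"
  unfolding QI_space_def
  by (rule quotient_group_mult[OF equiv_qi_equiv compose_quasi_isometry compose_qi_equiv
        compose_qi_assoc qi_identity compose_qi_identity quasi_inverse assms])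

end

section \<open>Commensurations as quasi-isometries\<close>

locale fg_group = group +
  fixes S
  assumes generating: "finite_generating_set G S"
begin

section \<open>Word length and the word metric\<close>

abbreviation letters :: "'a set" where
  "letters \<equiv> S \<union> m_inv G ` S"

abbreviation word_eval :: "'a list \<Rightarrow> 'a" where
  "word_eval w \<equiv> foldr (\<lambda>x y. x \<otimes> y) w \<one>"

abbreviation d :: "'a \<Rightarrow> 'a \<Rightarrow> real" where
  "d \<equiv> word_metric G S"

abbreviation len :: "'a \<Rightarrow> nat" where
  "len \<equiv> word_length G S"

lemma letters: "finite letters" "letters \<subseteq> carrier G" "s \<in> letters \<Longrightarrow> inv s \<in> letters"
  using generating by (auto simp: finite_generating_set_def subset_iff)

lemma word_eval_closed: "set w \<subseteq> letters \<Longrightarrow> word_eval w \<in> carrier G"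
proof (induction w)
  case (Cons s w)
  have "s \<in> carrier G"
    using Cons.prems letters(2) by auto
  then show ?case
    using Cons by simp
qed simp

lemma word_eval_append:
  "set v \<subseteq> letters \<Longrightarrow> set w \<subseteq> letters \<Longrightarrow> word_eval (v @ w) = word_eval v \<otimes> word_eval w"
proof (induction v)
  case (Cons s v)
  have "s \<in> carrier G"
    using Cons.prems letters(2) by auto
  then show ?case
    using Cons word_eval_closed[of v] word_eval_closed[of w] by (simp add: m_assoc)
qed (simp add: word_eval_closed)

lemma word_eval_rev_inv:
  "set w \<subseteq> letters \<Longrightarrow> set (rev (map (m_inv G) w)) \<subseteq> letters \<and>
     word_eval (rev (map (m_inv G) w)) = inv (word_eval w)"
proof (induction w)
  case (Cons s w)
  have s: "s \<in> letters" "s \<in> carrier G"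
    using Cons.prems letters(2) by auto
  then show ?case
    using Cons letters(3)[OF s(1)] word_eval_closed[of w]
      word_eval_append[of "rev (map (m_inv G) w)" "[inv s]"]
    by (simp add: inv_mult_group del: foldr_append)
qed simp

lemma word_exists:
  assumes "g \<in> carrier G"
  shows "\<exists>w. set w \<subseteq> letters \<and> word_eval w = g"
proof -
  have S: "S \<subseteq> carrier G" "g \<in> generate G S"
    using generating assms by (auto simp: finite_generating_set_def)
  from S(2) show ?thesis
  proof induction
    case one
    show ?case by (intro exI[of _ "[]"]) simp
  next
    case (incl h)
    then show ?case using S(1) by (intro exI[of _ "[h]"]) auto
  next
    case (inv h)
    then show ?case using S(1) by (intro exI[of _ "[inv h]"]) auto
  next
    case (eng g h)
    then obtain v w where "set v \<subseteq> letters" "word_eval v = g" "set w \<subseteq> letters" "word_eval w = h"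
      by blast
    then show ?case
      using word_eval_append[of v w] by (intro exI[of _ "v @ w"]) (simp del: foldr_append)
  qed
qed

text \<open>Generation supplies some word for g, so the \<open>LEAST\<close> in
  \<open>word_length\<close> is attained, by a shortest word.\<close>

lemma word_lengthE:
  assumes "g \<in> carrier G"
  obtains w where "set w \<subseteq> letters" "word_eval w = g" "length w = len g"
proof -
  have "\<exists>n. \<exists>w. length w = n \<and> set w \<subseteq> letters \<and> word_eval w = g"
    using word_exists[OF assms] by blast
  from LeastI_ex[OF this] show thesis
    using that unfolding word_length_def by blast
qed

lemma word_length_le: "set w \<subseteq> letters \<Longrightarrow> len (word_eval w) \<le> length w"
  unfolding word_length_def by (rule Least_le) blast

lemma word_length_one: "len \<one> = 0"
  using word_length_le[of "[]"] by simp

lemma word_length_letter: "s \<in> letters \<Longrightarrow> len s \<le> 1"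
  using word_length_le[of "[s]"] letters(2) by (auto simp: subset_iff)

lemma word_length_mult:
  assumes "g \<in> carrier G" "h \<in> carrier G"
  shows "len (g \<otimes> h) \<le> len g + len h"
proof -
  obtain v w where "set v \<subseteq> letters" "word_eval v = g" "length v = len g"
    "set w \<subseteq> letters" "word_eval w = h" "length w = len h"
    using assms word_lengthE by metis
  then show ?thesis
    using word_length_le[of "v @ w"] word_eval_append[of v w] by (simp del: foldr_append)
qed

lemma word_length_inv_le:
  assumes "g \<in> carrier G"
  shows "len (inv g) \<le> len g"
proof -
  obtain w where "set w \<subseteq> letters" "word_eval w = g" "length w = len g"
    using assms word_lengthE by metis
  then show ?thesis
    using word_length_le[of "rev (map (m_inv G) w)"] word_eval_rev_inv[of w] by simp
qed

lemma word_length_inv: "g \<in> carrier G \<Longrightarrow> len (inv g) = len g"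
  using word_length_inv_le[of g] word_length_inv_le[of "inv g"] by simp

text \<open>A finite alphabet admits only finitely many words of bounded length. This is where
  finite generation enters both the control of commensurations and the injectivity argument.\<close>

lemma finite_ball: "finite {g \<in> carrier G. len g \<le> n}"
proof (rule finite_subset)
  show "{g \<in> carrier G. len g \<le> n} \<subseteq> word_eval ` {w. set w \<subseteq> letters \<and> length w \<le> n}"
  proof
    fix g assume "g \<in> {g \<in> carrier G. len g \<le> n}"
    then show "g \<in> word_eval ` {w. set w \<subseteq> letters \<and> length w \<le> n}"
      using word_lengthE[of g] by (metis (mono_tags, lifting) imageI mem_Collect_eq)
  qed
  show "finite (word_eval ` {w. set w \<subseteq> letters \<and> length w \<le> n})"
    using finite_lists_length_le[OF letters(1)] by simp
qed

lemma word_metric_mult: "x \<in> carrier G \<Longrightarrow> t \<in> carrier G \<Longrightarrow> d x (x \<otimes> t) = len t"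
  by (simp add: word_metric_def m_assoc[symmetric])

sublocale pseudometric_on "carrier G" d
proof
  fix x y z assume xyz: "x \<in> carrier G" "y \<in> carrier G" "z \<in> carrier G"
  have "inv x \<otimes> z = (inv x \<otimes> y) \<otimes> (inv y \<otimes> z)"
    using xyz by (metis inv_closed inv_solve_left m_assoc m_closed)
  then show "d x z \<le> d x y + d y z"
    using xyz word_length_mult[of "inv x \<otimes> y" "inv y \<otimes> z"] by (simp add: word_metric_def)
next
  fix x y assume xy: "x \<in> carrier G" "y \<in> carrier G"
  then show "d x y = d y x"
    using word_length_inv[of "inv x \<otimes> y"] by (simp add: word_metric_def inv_mult_group)
qed (simp_all add: word_metric_def word_length_one)

section \<open>Commensurations induce quasi-isometries\<close>

lemma commensuration_bornologous:
  assumes "(A, B, \<alpha>) \<in> commensurations G"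
  obtains N where "N \<ge> 0" "\<And>x y. x \<in> A \<Longrightarrow> y \<in> A \<Longrightarrow> d x y \<le> M \<Longrightarrow> d (\<alpha> x) (\<alpha> y) \<le> N"
proof -
  note D = commensurationsD[OF assms]
  \<comment> \<open>Word lengths are natural numbers, so the real radius M may be rounded down. F
    may leave A, where \<alpha> takes the value \<open>undefined\<close>; this merely adds one more
    length to a finite set.\<close>
  define F where "F = {g \<in> carrier G. len g \<le> nat \<lfloor>M\<rfloor>}"
  have "finite ((\<lambda>g. len (\<alpha> g)) ` F)"
    unfolding F_def using finite_ball by blast
  then obtain n where n: "\<And>g. g \<in> F \<Longrightarrow> len (\<alpha> g) \<le> n"
    unfolding finite_nat_set_iff_bounded_le by blast
  have "d (\<alpha> x) (\<alpha> y) \<le> real n" if xy: "x \<in> A" "y \<in> A" "d x y \<le> M" for x y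
  proof -
    have "inv x \<in> A"
      using D(6) xy(1) by (rule subgroup.m_inv_closed)
    then have eq: "inv (\<alpha> x) \<otimes> \<alpha> y = \<alpha> (inv x \<otimes> y)"
      using D(4) xy commensuration_inv[OF assms] by simp
    have "len (inv x \<otimes> y) \<le> nat \<lfloor>M\<rfloor>"
      using xy(3) by (simp add: word_metric_def le_nat_floor)
    then have "inv x \<otimes> y \<in> F"
      using xy D(9) by (simp add: F_def)
    then show ?thesis
      using n eq by (simp add: word_metric_def)
  qed
  then show thesis
    by (intro that[of "real n"]) auto
qed

text \<open>A shortest word for x^-1 y is a path from x to y with steps of one letter, and each step
  moves the image by at most K. This upgrades control at one scale to a linear bound at all
  scales.\<close>

lemma lipschitz_from_letters:
  assumes f: "\<And>x. x \<in> carrier G \<Longrightarrow> f x \<in> carrier G"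
    and K: "\<And>x s. x \<in> carrier G \<Longrightarrow> s \<in> letters \<Longrightarrow> d (f x) (f (x \<otimes> s)) \<le> K"
    and xy: "x \<in> carrier G" "y \<in> carrier G"
  shows "d (f x) (f y) \<le> K * d x y"
proof -
  \<comment> \<open>The starting point is kept general because after the first letter s the rest of
    the path starts at x s.\<close>
  have *: "d (f x) (f (x \<otimes> word_eval w)) \<le> K * length w" if "x \<in> carrier G" "set w \<subseteq> letters" for x w
    using that
  proof (induction w arbitrary: x)
    case Nil
    then show ?case using f by (simp add: refl)
  next
    case (Cons s w)
    have s: "s \<in> letters" "s \<in> carrier G" "set w \<subseteq> letters"
      using Cons.prems letters(2) by auto
    have w: "word_eval w \<in> carrier G"
      using s(3) by (rule word_eval_closed)
    have "d (f x) (f (x \<otimes> word_eval (s # w))) \<le>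
        d (f x) (f (x \<otimes> s)) + d (f (x \<otimes> s)) (f (x \<otimes> s \<otimes> word_eval w))"
      using triangle[of "f x" "f (x \<otimes> s)" "f (x \<otimes> s \<otimes> word_eval w)"] Cons.prems(1) s w f
      by (simp add: m_assoc)
    also have "\<dots> \<le> K + K * length w"
      using K[OF Cons.prems(1) s(1)] Cons.IH[of "x \<otimes> s"] Cons.prems(1) s by fastforce
    finally show ?case
      by (simp add: algebra_simps)
  qed
  obtain w where w: "set w \<subseteq> letters" "word_eval w = inv x \<otimes> y" "length w = len (inv x \<otimes> y)"
    using word_lengthE[of "inv x \<otimes> y"] xy by auto
  have "x \<otimes> (inv x \<otimes> y) = y"
    using xy by (simp add: m_assoc[symmetric])
  then show ?thesis
    using *[OF xy(1) w(1)] w by (simp add: word_metric_def)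
qed

lemma bounded_maps_intoE:
  assumes "p \<in> bounded_maps_into G S A"
  obtains M where "M \<ge> 0" "\<And>x. x \<in> carrier G \<Longrightarrow> p x \<in> A" "\<And>x. x \<in> carrier G \<Longrightarrow> d (p x) x \<le> M"
proof -
  obtain M where M: "p \<in> carrier G \<rightarrow>\<^sub>E A" "\<forall>x\<in>carrier G. d (p x) x \<le> M"
    using assms unfolding bounded_maps_into_def by blast
  then have "\<forall>x\<in>carrier G. d (p x) x \<le> max M 0"
    by (auto intro: max.coboundedI1)
  then show thesis
    using M(1) by (intro that[of "max M 0"]) auto
qed

lemma bounded_maps_into_mem: "p \<in> bounded_maps_into G S A \<Longrightarrow> x \<in> carrier G \<Longrightarrow> p x \<in> A"
  by (auto simp: bounded_maps_into_def)

text \<open>Writing g = a t with a in A and t in a finite set T, the map sends g to a. The metric is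
  left invariant, so the displacement is the length of t, which is bounded on T.\<close>

lemma bounded_maps_into_nonempty:
  assumes "finite_index_subgroup A G"
  obtains p where "p \<in> bounded_maps_into G S A"
proof -
  obtain T where T: "finite T" "T \<subseteq> carrier G"
    "\<And>g. g \<in> carrier G \<Longrightarrow> \<exists>a\<in>A. \<exists>t\<in>T. g = a \<otimes> t"
    using finite_index_subgroupE[OF assms] by blast
  then obtain p where p: "\<And>g. g \<in> carrier G \<Longrightarrow> p g \<in> A \<and> (\<exists>t\<in>T. g = p g \<otimes> t)"
    by metis
  obtain n where n: "\<And>t. t \<in> T \<Longrightarrow> len t \<le> n"
    using T(1) finite_nat_set_iff_bounded_le[of "len ` T"] by auto
  have A: "A \<subseteq> carrier G"
    using assms subgroup.subset by (auto simp: finite_index_subgroup_def)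
  have "d (p x) x \<le> real n" if x: "x \<in> carrier G" for x
  proof -
    obtain t where t: "t \<in> T" "x = p x \<otimes> t"
      using p[OF x] by blast
    then show ?thesis
      using word_metric_mult[of "p x" t] n[OF t(1)] p[OF x] A T(2) by fastforce
  qed
  then have "restrict p (carrier G) \<in> bounded_maps_into G S A"
    using p by (auto simp: bounded_maps_into_def)
  then show thesis by (rule that)
qed

lemma commensuration_lipschitz:
  assumes "(A, B, \<alpha>) \<in> commensurations G" "p \<in> bounded_maps_into G S A"
  obtains K where "K \<ge> 1"
    "\<And>x y. x \<in> carrier G \<Longrightarrow> y \<in> carrier G \<Longrightarrow> d (\<alpha> (p x)) (\<alpha> (p y)) \<le> K * d x y"
proof -
  note D = commensurationsD[OF assms(1)]
  obtain M where M: "M \<ge> 0" "\<And>x. x \<in> carrier G \<Longrightarrow> p x \<in> A" "\<And>x. x \<in> carrier G \<Longrightarrow> d (p x) x \<le> M"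
    by (rule bounded_maps_intoE[OF assms(2)]) blast
  \<comment> \<open>For x and x s one letter apart, p moves each of the two by at most M, which
    gives 2 M + 1.\<close>
  obtain N where N: "\<And>x y. x \<in> A \<Longrightarrow> y \<in> A \<Longrightarrow> d x y \<le> 2 * M + 1 \<Longrightarrow> d (\<alpha> x) (\<alpha> y) \<le> N"
    by (rule commensuration_bornologous[OF assms(1), of "2 * M + 1"]) blast
  \<comment> \<open>The maximum secures K \<ge> 1, as the multiplicative constant of a
    quasi-isometry must be.\<close>
  define K where "K = max 1 N"
  have "d (\<alpha> (p x)) (\<alpha> (p (x \<otimes> s))) \<le> K" if x: "x \<in> carrier G" and s: "s \<in> letters" for x s
  proof -
    have sc: "s \<in> carrier G" "x \<otimes> s \<in> carrier G"
      using s letters(2) x by auto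
    have pc: "p x \<in> carrier G" "p (x \<otimes> s) \<in> carrier G"
      using M(2) D(9) x sc by auto
    have "d (p x) (p (x \<otimes> s)) \<le> d (p x) x + d x (p (x \<otimes> s))"
      "d x (p (x \<otimes> s)) \<le> d x (x \<otimes> s) + d (x \<otimes> s) (p (x \<otimes> s))"
      using triangle x sc pc by auto
    moreover have "d x (x \<otimes> s) \<le> 1"
      using word_metric_mult[OF x sc(1)] word_length_letter[OF s] by simp
    moreover have "d (x \<otimes> s) (p (x \<otimes> s)) \<le> M"
      using M(3)[OF sc(2)] sym[OF sc(2) pc(2)] by simp
    ultimately have "d (p x) (p (x \<otimes> s)) \<le> 2 * M + 1"
      using M(3)[OF x] by linarith
    then show ?thesis
      using N M(2) x sc by (fastforce simp: K_def)
  qed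
  then show thesis
    using lipschitz_from_letters[of "\<lambda>x. \<alpha> (p x)" K] D(10) M(2)
    by (intro that[of K]) (auto simp: K_def)
qed

text \<open>The upper bound is the Lipschitz estimate for \<alpha> after p. The lower bound is the
  same estimate for the inverse \<beta> after some bounded map q into B, because this second map is
  a coarse inverse of the first.\<close>

lemma commensuration_quasi_isometry:
  assumes \<alpha>: "(A, B, \<alpha>) \<in> commensurations G" and p: "p \<in> bounded_maps_into G S A"
  shows "compose (carrier G) \<alpha> p \<in> quasi_isometries (carrier G) d"
proof -
  define \<beta> where "\<beta> = restrict (inv_into A \<alpha>) B"
  have \<beta>: "(B, A, \<beta>) \<in> commensurations G"
    unfolding \<beta>_def using \<alpha> by (rule commensuration_inverse)
  note A = commensurationsD[OF \<alpha>] and B = commensurationsD[OF \<beta>]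
  have \<beta>\<alpha>: "\<beta> (\<alpha> x) = x" if "x \<in> A" for x
    using that A(3) A(8)[OF that] by (simp add: \<beta>_def bij_betw_def)
  have \<alpha>\<beta>: "\<alpha> (\<beta> y) = y" if "y \<in> B" for y
    using that A(3) by (auto simp: \<beta>_def bij_betw_def f_inv_into_f)
  obtain q where q: "q \<in> bounded_maps_into G S B"
    by (rule bounded_maps_into_nonempty[OF A(2)]) blast
  obtain M where M: "M \<ge> 0" "\<And>x. x \<in> carrier G \<Longrightarrow> p x \<in> A" "\<And>x. x \<in> carrier G \<Longrightarrow> d (p x) x \<le> M"
    by (rule bounded_maps_intoE[OF p]) blast
  obtain M' where M': "M' \<ge> 0" "\<And>x. x \<in> carrier G \<Longrightarrow> q x \<in> B" "\<And>x. x \<in> carrier G \<Longrightarrow> d (q x) x \<le> M'"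
    by (rule bounded_maps_intoE[OF q]) blast
  obtain K where K: "K \<ge> 1"
    "\<And>x y. x \<in> carrier G \<Longrightarrow> y \<in> carrier G \<Longrightarrow> d (\<alpha> (p x)) (\<alpha> (p y)) \<le> K * d x y"
    using commensuration_lipschitz[OF \<alpha> p] by blast
  obtain L where L: "L \<ge> 1"
    "\<And>x y. x \<in> carrier G \<Longrightarrow> y \<in> carrier G \<Longrightarrow> d (\<beta> (q x)) (\<beta> (q y)) \<le> L * d x y"
    using commensuration_lipschitz[OF \<beta> q] by blast
  obtain N where N: "N \<ge> 0" "\<And>x y. x \<in> A \<Longrightarrow> y \<in> A \<Longrightarrow> d x y \<le> M \<Longrightarrow> d (\<alpha> x) (\<alpha> y) \<le> N"
    by (rule commensuration_bornologous[OF \<alpha>]) blast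
  obtain N' where N': "N' \<ge> 0" "\<And>x y. x \<in> B \<Longrightarrow> y \<in> B \<Longrightarrow> d x y \<le> M' \<Longrightarrow> d (\<beta> x) (\<beta> y) \<le> N'"
    by (rule commensuration_bornologous[OF \<beta>]) blast
  \<comment> \<open>Applying q to \<alpha>(p x) moves it by at most M', hence its image under
    \<beta> by at most N' away from \<beta>(\<alpha>(p x)) = p x, which is within M of x.\<close>
  have near: "d x (\<beta> (q (\<alpha> (p x)))) \<le> M + N'" "d (\<beta> (q (\<alpha> (p x)))) x \<le> M + N'"
    if x: "x \<in> carrier G" for x
  proof -
    have px: "p x \<in> A" "p x \<in> carrier G" "\<alpha> (p x) \<in> B" "\<alpha> (p x) \<in> carrier G"
      using M(2)[OF x] A(8,9,10) by auto
    have z: "\<beta> (q (\<alpha> (p x))) \<in> carrier G"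
      using M'(2)[OF px(4)] B(10) by blast
    have "d (\<beta> (q (\<alpha> (p x)))) (\<beta> (\<alpha> (p x))) \<le> N'"
      using N'(2) M'(2,3)[OF px(4)] px(3) by blast
    then have "d (\<beta> (q (\<alpha> (p x)))) (p x) \<le> N'"
      using \<beta>\<alpha>[OF px(1)] by simp
    moreover have "d (\<beta> (q (\<alpha> (p x)))) x \<le> d (\<beta> (q (\<alpha> (p x)))) (p x) + d (p x) x"
      using triangle z px(2) x by blast
    ultimately show "d (\<beta> (q (\<alpha> (p x)))) x \<le> M + N'"
      using M(3)[OF x] by linarith
    then show "d x (\<beta> (q (\<alpha> (p x)))) \<le> M + N'"
      using sym[OF x z] by simp
  qed
  define c where "c = max K L"
  \<comment> \<open>The part 2 M + 2 N' pays for \<open>near\<close> at both points in the lower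
    bound, and N + M' pays for coarse surjectivity.\<close>
  define C where "C = 2 * M + 2 * N' + N + M'"
  have c: "c \<ge> 1" "c \<ge> K" "c \<ge> L" and C: "C \<ge> 0" "C \<ge> 2 * M + 2 * N'"
    using K(1) M(1) M'(1) N(1) N'(1) by (auto simp: c_def C_def)
  show ?thesis
  proof (rule quasi_isometriesI[OF _ c(1) C(1)])
    show "compose (carrier G) \<alpha> p \<in> carrier G \<rightarrow>\<^sub>E carrier G"
      using M(2) A(10) by (auto simp: compose_def)
  next
    fix x y assume xy: "x \<in> carrier G" "y \<in> carrier G"
    let ?u = "\<alpha> (p x)" and ?v = "\<alpha> (p y)"
    have uv: "?u \<in> carrier G" "?v \<in> carrier G"
      using xy M(2) A(10) by auto
    have z: "\<beta> (q ?u) \<in> carrier G" "\<beta> (q ?v) \<in> carrier G"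
      using M'(2) uv B(10) by auto
    have "d ?u ?v \<le> c * d x y + C"
      using K(2)[OF xy] mult_right_mono[OF c(2) nonneg[OF xy]] C(1) by linarith
    then show "d (compose (carrier G) \<alpha> p x) (compose (carrier G) \<alpha> p y) \<le> c * d x y + C"
      using xy by (simp add: compose_eq)
    have "d x y \<le> d x (\<beta> (q ?u)) + d (\<beta> (q ?u)) y" "d (\<beta> (q ?u)) y \<le> d (\<beta> (q ?u)) (\<beta> (q ?v)) + d (\<beta> (q ?v)) y"
      using triangle xy z by auto
    then have "d x y \<le> L * d ?u ?v + C"
      using near(1)[OF xy(1)] near(2)[OF xy(2)] L(2)[OF uv] C(2) by linarith
    also have "\<dots> \<le> c * d ?u ?v + c * C"
      using mult_right_mono[OF c(3) nonneg[OF uv]] mult_right_mono[OF c(1) C(1)] by simp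
    finally show "d x y \<le> c * (d (compose (carrier G) \<alpha> p x) (compose (carrier G) \<alpha> p y) + C)"
      using xy by (simp add: compose_eq distrib_left)
  next
    fix y assume y: "y \<in> carrier G"
    \<comment> \<open>This x satisfies \<alpha>(x) = q(y), which is within M' of y; replacing x by
      p(x) moves the image under \<alpha> by at most N.\<close>
    define x where "x = \<beta> (q y)"
    have x: "x \<in> A" "x \<in> carrier G" "\<alpha> x = q y"
      using M'(2)[OF y] B(8,10) \<alpha>\<beta> by (auto simp: x_def)
    have "d (\<alpha> (p x)) (\<alpha> x) \<le> N"
      using N(2) M(2,3)[OF x(2)] x(1) by blast
    moreover have "d (\<alpha> (p x)) y \<le> d (\<alpha> (p x)) (\<alpha> x) + d (\<alpha> x) y"
      using triangle A(10) M(2)[OF x(2)] x(1) y by blast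
    moreover have "d (\<alpha> x) y \<le> M'"
      using M'(3)[OF y] x(3) by simp
    ultimately have "d (\<alpha> (p x)) y \<le> C"
      using M(1) N'(1) by (simp add: C_def)
    then show "\<exists>x\<in>carrier G. d (compose (carrier G) \<alpha> p x) y \<le> C"
      using x(2) by (auto simp: compose_eq)
  qed
qed

section \<open>Independence of representatives and of the bounded maps\<close>

lemma bounded_maps_near:
  assumes p: "p \<in> bounded_maps_into G S A" and q: "q \<in> bounded_maps_into G S B"
    and "A \<subseteq> carrier G" "B \<subseteq> carrier G"
  obtains M where "\<And>x. x \<in> carrier G \<Longrightarrow> d (p x) (q x) \<le> M"
proof -
  obtain M where M: "\<And>x. x \<in> carrier G \<Longrightarrow> p x \<in> A" "\<And>x. x \<in> carrier G \<Longrightarrow> d (p x) x \<le> M"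
    by (rule bounded_maps_intoE[OF p]) blast
  obtain N where N: "\<And>x. x \<in> carrier G \<Longrightarrow> q x \<in> B" "\<And>x. x \<in> carrier G \<Longrightarrow> d (q x) x \<le> N"
    by (rule bounded_maps_intoE[OF q]) blast
  have "d (p x) (q x) \<le> M + N" if x: "x \<in> carrier G" for x
  proof -
    have c: "p x \<in> carrier G" "q x \<in> carrier G"
      using M(1) N(1) assms(3,4) x by auto
    show ?thesis
      using triangle[OF c(1) x c(2)] sym[OF c(2) x] M(2)[OF x] N(2)[OF x] by linarith
  qed
  then show thesis by (rule that)
qed

text \<open>The maps p and q may have different targets, so both are compared with a third bounded
  map r into the subgroup H on which \<alpha> and \<beta> agree.\<close>

lemma com_equiv_imp_qi_equiv:
  assumes eq: "((A, B, \<alpha>), (C, D, \<beta>)) \<in> com_equiv G"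
    and p: "p \<in> bounded_maps_into G S A" and q: "q \<in> bounded_maps_into G S C"
  shows "(compose (carrier G) \<alpha> p, compose (carrier G) \<beta> q) \<in> qi_equiv (carrier G) d"
proof -
  obtain H where H: "(A, B, \<alpha>) \<in> commensurations G" "(C, D, \<beta>) \<in> commensurations G"
    "finite_index_subgroup H G" "H \<subseteq> A" "H \<subseteq> C" "\<And>x. x \<in> H \<Longrightarrow> \<alpha> x = \<beta> x"
    using com_equivE[OF eq] by metis
  note A = commensurationsD[OF H(1)] and C = commensurationsD[OF H(2)]
  obtain r where r: "r \<in> bounded_maps_into G S H"
    by (rule bounded_maps_into_nonempty[OF H(3)]) blast
  have sub: "A \<subseteq> carrier G" "C \<subseteq> carrier G" "H \<subseteq> carrier G"
    using A(9) C(9) H(4) by auto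
  obtain M where M: "\<And>x. x \<in> carrier G \<Longrightarrow> d (p x) (r x) \<le> M"
    by (rule bounded_maps_near[OF p r sub(1,3)]) blast
  obtain M' where M': "\<And>x. x \<in> carrier G \<Longrightarrow> d (r x) (q x) \<le> M'"
    by (rule bounded_maps_near[OF r q sub(3,2)]) blast
  obtain N where N: "\<And>x y. x \<in> A \<Longrightarrow> y \<in> A \<Longrightarrow> d x y \<le> M \<Longrightarrow> d (\<alpha> x) (\<alpha> y) \<le> N"
    by (rule commensuration_bornologous[OF H(1)]) blast
  obtain N' where N': "\<And>x y. x \<in> C \<Longrightarrow> y \<in> C \<Longrightarrow> d x y \<le> M' \<Longrightarrow> d (\<beta> x) (\<beta> y) \<le> N'"
    by (rule commensuration_bornologous[OF H(2)]) blast
  show ?thesis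
  proof (rule qi_equivI)
    fix x assume x: "x \<in> carrier G"
    have m: "p x \<in> A" "q x \<in> C" "r x \<in> H" "r x \<in> A" "r x \<in> C"
      using bounded_maps_into_mem[OF p x] bounded_maps_into_mem[OF q x] bounded_maps_into_mem[OF r x]
        H(4,5) by auto
    have "d (\<alpha> (p x)) (\<beta> (q x)) \<le> d (\<alpha> (p x)) (\<alpha> (r x)) + d (\<beta> (r x)) (\<beta> (q x))"
      using triangle[OF A(10)[OF m(1)] A(10)[OF m(4)] C(10)[OF m(2)]] H(6)[OF m(3)] by simp
    also have "\<dots> \<le> N + N'"
      using N[OF m(1,4) M[OF x]] N'[OF m(5,2) M'[OF x]] by linarith
    finally show "d (compose (carrier G) \<alpha> p x) (compose (carrier G) \<beta> q x) \<le> N + N'"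
      using x by (simp add: compose_eq)
  qed (use commensuration_quasi_isometry H p q in auto)
qed

text \<open>All sets in the union defining \<open>Com_to_QI\<close> are the same class, and the
  given representative with p shows that the union is not empty.\<close>

lemma Com_to_QI_class:
  assumes \<alpha>: "(A, B, \<alpha>) \<in> commensurations G" and p: "p \<in> bounded_maps_into G S A"
  shows "Com_to_QI G S (com_equiv G `` {(A, B, \<alpha>)}) = qi_equiv (carrier G) d `` {compose (carrier G) \<alpha> p}"
proof -
  let ?Q = "qi_equiv (carrier G) d"
  have "?Q `` {compose (carrier G) \<beta> q} = ?Q `` {compose (carrier G) \<alpha> p}"
    if "((A, B, \<alpha>), (C, D, \<beta>)) \<in> com_equiv G" "q \<in> bounded_maps_into G S C" for C D \<beta> q
    using equiv_class_eq[OF equiv_qi_equiv com_equiv_imp_qi_equiv[OF that(1) p that(2)]] by simp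
  then show ?thesis
    using equiv_class_self[OF equiv_com_equiv \<alpha>] p unfolding Com_to_QI_def by fast
qed

lemma carrier_Com_cases:
  assumes "c \<in> carrier (Com G)"
  obtains A B \<alpha> p where "(A, B, \<alpha>) \<in> commensurations G" "c = com_equiv G `` {(A, B, \<alpha>)}"
    "p \<in> bounded_maps_into G S A"
proof -
  obtain a where a: "a \<in> commensurations G" "c = com_equiv G `` {a}"
    using assms by (auto simp: Com_def elim: quotientE)
  obtain A B \<alpha> where eq: "a = (A, B, \<alpha>)"
    by (metis prod_cases3)
  obtain p where "p \<in> bounded_maps_into G S A"
    using a(1) commensurationsD(1) bounded_maps_into_nonempty unfolding eq by metis
  then show thesis
    using that a unfolding eq by blast
qed

section \<open>The homomorphism property\<close>

lemma Com_to_QI_hom: "Com_to_QI G S \<in> hom (Com G) (QI G S)"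
proof (rule homI)
  fix c assume "c \<in> carrier (Com G)"
  then show "Com_to_QI G S c \<in> carrier (QI G S)"
    by (elim carrier_Com_cases)
      (simp add: Com_to_QI_class QI_def QI_space_def quotientI commensuration_quasi_isometry)
next
  fix b a assume "b \<in> carrier (Com G)" and "a \<in> carrier (Com G)"
  obtain A B \<alpha> p where a: "(A, B, \<alpha>) \<in> commensurations G" "a = com_equiv G `` {(A, B, \<alpha>)}"
    and p: "p \<in> bounded_maps_into G S A"
    using carrier_Com_cases[OF \<open>a \<in> carrier (Com G)\<close>] by metis
  obtain C D \<beta> q where b: "(C, D, \<beta>) \<in> commensurations G" "b = com_equiv G `` {(C, D, \<beta>)}"
    and q: "q \<in> bounded_maps_into G S C"
    using carrier_Com_cases[OF \<open>b \<in> carrier (Com G)\<close>] by metis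
  note A = commensurationsD[OF a(1)] and C = commensurationsD[OF b(1)]
  define E where "E = {x \<in> A. \<alpha> x \<in> B \<inter> C}"
  have comp: "com_comp (C, D, \<beta>) (A, B, \<alpha>) = (E, \<beta> ` (B \<inter> C), compose E \<beta> \<alpha>)"
    by (simp add: E_def Let_def)
  have E: "(E, \<beta> ` (B \<inter> C), compose E \<beta> \<alpha>) \<in> commensurations G"
    using com_comp_closed[OF b(1) a(1)] comp by simp
  \<comment> \<open>The product of commensurations lives on the smaller domain E and needs its own
    bounded map r, whereas the product of quasi-isometries inserts q between \<alpha> and \<beta>.
    The two results must be shown to be close.\<close>
  obtain r where r: "r \<in> bounded_maps_into G S E"
    using bounded_maps_into_nonempty[OF commensurationsD(1)[OF E]] by blast
  have sub: "A \<subseteq> carrier G" "E \<subseteq> carrier G"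
    using A(9) by (auto simp: E_def)
  have qi: "compose (carrier G) \<alpha> p \<in> quasi_isometries (carrier G) d"
    "compose (carrier G) \<beta> q \<in> quasi_isometries (carrier G) d"
    "compose (carrier G) (compose E \<beta> \<alpha>) r \<in> quasi_isometries (carrier G) d"
    using commensuration_quasi_isometry a b E p q r by auto
  obtain M where M: "\<And>x. x \<in> carrier G \<Longrightarrow> d (r x) (p x) \<le> M"
    by (rule bounded_maps_near[OF r p sub(2,1)]) blast
  obtain N where N: "\<And>x y. x \<in> A \<Longrightarrow> y \<in> A \<Longrightarrow> d x y \<le> M \<Longrightarrow> d (\<alpha> x) (\<alpha> y) \<le> N"
    by (rule commensuration_bornologous[OF a(1)]) blast
  obtain M' where M': "\<And>x. x \<in> carrier G \<Longrightarrow> q x \<in> C" "\<And>x. x \<in> carrier G \<Longrightarrow> d (q x) x \<le> M'"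
    by (rule bounded_maps_intoE[OF q]) blast
  \<comment> \<open>\<beta> is applied to \<alpha>(r x) and q(\<alpha>(p x)), both in C. Exchanging
    r for p costs N and the displacement of q costs M'.\<close>
  obtain N' where N': "\<And>x y. x \<in> C \<Longrightarrow> y \<in> C \<Longrightarrow> d x y \<le> N + M' \<Longrightarrow> d (\<beta> x) (\<beta> y) \<le> N'"
    by (rule commensuration_bornologous[OF b(1)]) blast
  have "(compose (carrier G) (compose E \<beta> \<alpha>) r,
      compose (carrier G) (compose (carrier G) \<beta> q) (compose (carrier G) \<alpha> p)) \<in> qi_equiv (carrier G) d"
  proof (rule qi_equivI)
    fix x assume x: "x \<in> carrier G"
    have rx: "r x \<in> E" "r x \<in> A" "\<alpha> (r x) \<in> C"
      using bounded_maps_into_mem[OF r x] by (auto simp: E_def)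
    have px: "p x \<in> A" "\<alpha> (p x) \<in> carrier G"
      using bounded_maps_into_mem[OF p x] A(10) by auto
    have "d (\<alpha> (r x)) (q (\<alpha> (p x))) \<le> d (\<alpha> (r x)) (\<alpha> (p x)) + d (q (\<alpha> (p x))) (\<alpha> (p x))"
      using triangle[of "\<alpha> (r x)" "\<alpha> (p x)" "q (\<alpha> (p x))"] sym[of "\<alpha> (p x)" "q (\<alpha> (p x))"]
        C(9) M'(1) rx px by simp
    also have "\<dots> \<le> N + M'"
      using N[OF rx(2) px(1) M[OF x]] M'(2)[OF px(2)] by linarith
    finally have "d (\<beta> (\<alpha> (r x))) (\<beta> (q (\<alpha> (p x)))) \<le> N'"
      using N' rx(3) M'(1)[OF px(2)] by blast
    then show "d (compose (carrier G) (compose E \<beta> \<alpha>) r x)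
        (compose (carrier G) (compose (carrier G) \<beta> q) (compose (carrier G) \<alpha> p) x) \<le> N'"
      using x rx(1) px(2) by (simp add: compose_eq)
  qed (use qi compose_quasi_isometry in auto)
  then have "Com_to_QI G S (b \<otimes>\<^bsub>Com G\<^esub> a) =
      qi_equiv (carrier G) d `` {compose (carrier G) (compose (carrier G) \<beta> q) (compose (carrier G) \<alpha> p)}"
    unfolding a(2) b(2) Com_mult[OF b(1) a(1)] comp Com_to_QI_class[OF E r]
    by (rule equiv_class_eq[OF equiv_qi_equiv])
  then show "Com_to_QI G S (b \<otimes>\<^bsub>Com G\<^esub> a) = Com_to_QI G S b \<otimes>\<^bsub>QI G S\<^esub> Com_to_QI G S a"
    unfolding a(2) b(2) Com_to_QI_class[OF a(1) p] Com_to_QI_class[OF b(1) q] QI_def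
    using QI_space_mult[OF qi(2,1)] by simp
qed

section \<open>Injectivity\<close>

lemma qi_equiv_imp_com_equiv:
  assumes \<alpha>: "(A, B, \<alpha>) \<in> commensurations G" and \<beta>: "(C, D, \<beta>) \<in> commensurations G"
    and p: "p \<in> bounded_maps_into G S A" and q: "q \<in> bounded_maps_into G S C"
    and eq: "(compose (carrier G) \<alpha> p, compose (carrier G) \<beta> q) \<in> qi_equiv (carrier G) d"
  shows "((A, B, \<alpha>), (C, D, \<beta>)) \<in> com_equiv G"
proof -
  note A = commensurationsD[OF \<alpha>] and C = commensurationsD[OF \<beta>]
  define E where "E = A \<inter> C"
  have E: "finite_index_subgroup E G" "subgroup E G"
    using finite_index_subgroup_Int[OF A(1) C(1)] by (auto simp: E_def finite_index_subgroup_def)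
  obtain M where M: "\<And>t. t \<in> carrier G \<Longrightarrow> d (\<alpha> (p t)) (\<beta> (q t)) \<le> M"
    using qi_equivE[OF eq] by (metis compose_eq)
  obtain P where P: "\<And>x. x \<in> carrier G \<Longrightarrow> p x \<in> A" "\<And>x. x \<in> carrier G \<Longrightarrow> d (p x) x \<le> P"
    by (rule bounded_maps_intoE[OF p]) blast
  obtain Q where Q: "\<And>x. x \<in> carrier G \<Longrightarrow> q x \<in> C" "\<And>x. x \<in> carrier G \<Longrightarrow> d (q x) x \<le> Q"
    by (rule bounded_maps_intoE[OF q]) blast
  obtain P' where P': "\<And>x y. x \<in> A \<Longrightarrow> y \<in> A \<Longrightarrow> d x y \<le> P \<Longrightarrow> d (\<alpha> x) (\<alpha> y) \<le> P'"
    by (rule commensuration_bornologous[OF \<alpha>]) blast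
  obtain Q' where Q': "\<And>x y. x \<in> C \<Longrightarrow> y \<in> C \<Longrightarrow> d x y \<le> Q \<Longrightarrow> d (\<beta> x) (\<beta> y) \<le> Q'"
    by (rule commensuration_bornologous[OF \<beta>]) blast
  define c where "c x = inv (\<alpha> x) \<otimes> \<beta> x" for x
  \<comment> \<open>The hypothesis compares \<alpha>(p x) with \<beta>(q x). Since p and q move x
    only a bounded distance, P' and Q' allow x itself to replace p(x) and q(x).\<close>
  have "c ` E \<subseteq> {g \<in> carrier G. len g \<le> nat \<lfloor>P' + M + Q'\<rfloor>}"
  proof
    fix g assume "g \<in> c ` E"
    then obtain x where x: "x \<in> A" "x \<in> C" "g = c x"
      by (auto simp: E_def)
    have xG: "x \<in> carrier G"
      using A(9) x by blast
    have m: "\<alpha> x \<in> carrier G" "\<alpha> (p x) \<in> carrier G" "\<beta> x \<in> carrier G" "\<beta> (q x) \<in> carrier G"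
      using A(10) C(10) x P(1)[OF xG] Q(1)[OF xG] by auto
    have "d (\<alpha> (p x)) (\<alpha> x) \<le> P'" "d (\<beta> (q x)) (\<beta> x) \<le> Q'"
      using P' Q' P[OF xG] Q[OF xG] x by auto
    moreover have "d (\<alpha> x) (\<beta> x) \<le> d (\<alpha> x) (\<alpha> (p x)) + d (\<alpha> (p x)) (\<beta> x)"
      "d (\<alpha> (p x)) (\<beta> x) \<le> d (\<alpha> (p x)) (\<beta> (q x)) + d (\<beta> (q x)) (\<beta> x)"
      using triangle m by auto
    ultimately have "d (\<alpha> x) (\<beta> x) \<le> P' + M + Q'"
      using M[OF xG] sym[OF m(1,2)] by linarith
    then show "g \<in> {g \<in> carrier G. len g \<le> nat \<lfloor>P' + M + Q'\<rfloor>}"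
      using m x by (simp add: c_def word_metric_def le_nat_floor)
  qed
  then have fin: "finite (c ` E)"
    using finite_ball finite_subset by blast
  define H where "H = {x \<in> E. \<alpha> x = \<beta> x}"
  have H: "subgroup H G"
  proof (rule subgroupI)
    show "H \<subseteq> carrier G"
      using A(9) by (auto simp: H_def E_def)
    have "\<alpha> \<one> = \<one>" "\<beta> \<one> = \<one>"
      using group_hom.hom_one[OF commensuration_group_hom] \<alpha> \<beta> by fastforce+
    then show "H \<noteq> {}"
      using subgroup.one_closed[OF E(2)] by (auto simp: H_def)
    fix x assume "x \<in> H"
    then show "inv x \<in> H"
      using commensuration_inv[OF \<alpha>] commensuration_inv[OF \<beta>] subgroup.m_inv_closed[OF E(2)]
      by (auto simp: H_def E_def)
    fix y assume "y \<in> H"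
    with \<open>x \<in> H\<close> show "x \<otimes> y \<in> H"
      using A(4) C(4) subgroup.m_closed[OF E(2)] by (auto simp: H_def E_def)
  qed
  \<comment> \<open>s picks one point of E for each value of c. These finitely many points represent
    the right cosets of H in E.\<close>
  define s where "s = inv_into E c"
  have s: "s g \<in> E \<and> c (s g) = g" if "g \<in> c ` E" for g
    using inv_into_into[OF that] f_inv_into_f[OF that] by (simp add: s_def)
  have "finite_index_subgroup H G"
  proof (rule finite_index_subgroup_trans[OF H E(1)])
    show "finite (s ` c ` E)"
      using fin by simp
    show "s ` c ` E \<subseteq> carrier G"
      using s subgroup.subset[OF E(2)] by blast
    show "H \<subseteq> E"
      by (auto simp: H_def)
    fix x assume x: "x \<in> E"
    define y where "y = s (c x)"
    have y: "y \<in> E" "c y = c x"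
      using s x by (auto simp: y_def)
    have m: "x \<in> A" "x \<in> C" "y \<in> A" "y \<in> C" "inv y \<in> A" "inv y \<in> C" "x \<otimes> inv y \<in> E"
      "x \<in> carrier G" "y \<in> carrier G"
      using x y subgroup.m_inv_closed[OF E(2)] subgroup.m_closed[OF E(2)] A(9) by (auto simp: E_def)
    have G: "\<alpha> x \<in> carrier G" "\<alpha> y \<in> carrier G" "\<beta> x \<in> carrier G" "\<beta> y \<in> carrier G"
      using A(10) C(10) m by auto
    have w: "c x \<in> carrier G" and "\<beta> x = \<alpha> x \<otimes> c x"
      using G by (simp_all add: c_def m_assoc[symmetric])
    moreover have "\<beta> y = \<alpha> y \<otimes> c x"
      unfolding y(2)[symmetric] using G by (simp add: c_def m_assoc[symmetric])
    moreover have "c x \<otimes> (inv (c x) \<otimes> inv (\<alpha> y)) = inv (\<alpha> y)"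
      using w G by (simp add: m_assoc[symmetric])
    \<comment> \<open>The common value of c at x and y cancels between \<beta>(x) and the inverse of
      \<beta>(y).\<close>
    ultimately have "\<alpha> x \<otimes> inv (\<alpha> y) = \<beta> x \<otimes> inv (\<beta> y)"
      using G by (simp add: inv_mult_group m_assoc)
    then have "\<alpha> (x \<otimes> inv y) = \<beta> (x \<otimes> inv y)"
      using A(4) C(4) m commensuration_inv[OF \<alpha>] commensuration_inv[OF \<beta>] by simp
    then have "x \<otimes> inv y \<in> H"
      using m by (simp add: H_def)
    moreover have "x = x \<otimes> inv y \<otimes> y"
      using m by (simp add: m_assoc)
    ultimately show "\<exists>h\<in>H. \<exists>t\<in>s ` c ` E. x = h \<otimes> t"
      using x unfolding y_def by blast
  qed
  then show ?thesis
    by (intro com_equivI[OF \<alpha> \<beta>]) (auto simp: H_def E_def)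
qed

lemma Com_to_QI_inj: "inj_on (Com_to_QI G S) (carrier (Com G))"
proof (rule inj_onI)
  fix a b assume "a \<in> carrier (Com G)" "b \<in> carrier (Com G)" and eq: "Com_to_QI G S a = Com_to_QI G S b"
  obtain A B \<alpha> p where a: "(A, B, \<alpha>) \<in> commensurations G" "a = com_equiv G `` {(A, B, \<alpha>)}"
    and p: "p \<in> bounded_maps_into G S A"
    using carrier_Com_cases[OF \<open>a \<in> carrier (Com G)\<close>] by metis
  obtain C D \<beta> q where b: "(C, D, \<beta>) \<in> commensurations G" "b = com_equiv G `` {(C, D, \<beta>)}"
    and q: "q \<in> bounded_maps_into G S C"
    using carrier_Com_cases[OF \<open>b \<in> carrier (Com G)\<close>] by metis
  have "(compose (carrier G) \<alpha> p, compose (carrier G) \<beta> q) \<in> qi_equiv (carrier G) d"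
    using eq eq_equiv_class[OF _ equiv_qi_equiv commensuration_quasi_isometry[OF b(1) q]]
    unfolding a(2) b(2) Com_to_QI_class[OF a(1) p] Com_to_QI_class[OF b(1) q] by blast
  then show "a = b"
    unfolding a(2) b(2)
    using equiv_class_eq[OF equiv_com_equiv qi_equiv_imp_com_equiv[OF a(1) b(1) p q]] by blast
qed

lemma Com_to_QI_group_hom: "group_hom (Com G) (QI G S) (Com_to_QI G S)"
  using group_Com group_QI_space Com_to_QI_hom
  by (simp add: group_hom_def group_hom_axioms_def QI_def)

end

section \<open>Thompson's group as a group\<close>

lemma dyadic_of_int: "of_int m / 2 ^ n \<in> dyadic_rationals"
  by (auto simp: dyadic_rationals_def)

lemma dyadic_mult:
  assumes "x \<in> dyadic_rationals" "y \<in> dyadic_rationals"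
  shows "x * y \<in> dyadic_rationals"
proof -
  obtain m n m' n' where "x = of_int m / 2 ^ n" "y = of_int m' / 2 ^ n'"
    using assms by (auto simp: dyadic_rationals_def)
  then have "x * y = of_int (m * m') / 2 ^ (n + n')"
    by (simp add: power_add)
  then show ?thesis
    by (metis dyadic_of_int)
qed

lemma dyadic_diff:
  assumes "x \<in> dyadic_rationals" "y \<in> dyadic_rationals"
  shows "x - y \<in> dyadic_rationals"
proof -
  obtain m n m' n' where "x = of_int m / 2 ^ n" "y = of_int m' / 2 ^ n'"
    using assms by (auto simp: dyadic_rationals_def)
  then have "x - y = of_int (m * 2 ^ n' - m' * 2 ^ n) / 2 ^ (n + n')"
    by (simp add: power_add diff_divide_distrib)
  then show ?thesis
    by (metis dyadic_of_int)
qed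

lemma dyadic_power2: "2 powi k \<in> dyadic_rationals"
proof (cases "k \<ge> 0")
  case True
  then show ?thesis
    using dyadic_of_int[of "2 ^ nat k" 0] by (simp add: power_int_def)
next
  case False
  then show ?thesis
    using dyadic_of_int[of 1 "nat (- k)"] by (simp add: power_int_def field_simps)
qed

lemma dyadic_dense:
  assumes "a < b"
  obtains t where "t \<in> dyadic_rationals" "a < t" "t < b"
proof -
  obtain n where n: "(1/2) ^ n < b - a"
    using assms real_arch_pow_inv[of "b - a" "1/2"] by auto
  \<comment> \<open>m is the least integer strictly above a 2^n; the added 1 makes the left
    inequality strict even when a is itself a multiple of 2^-n.\<close>
  define m where "m = \<lfloor>a * 2 ^ n\<rfloor> + 1"
  have "a * 2 ^ n < of_int m" "of_int m \<le> a * 2 ^ n + 1"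
    by (simp_all add: m_def)
  moreover have "1 < (b - a) * 2 ^ n"
    using n by (simp add: field_simps)
  ultimately have "a < of_int m / 2 ^ n" "of_int m / 2 ^ n < b"
    by (simp_all add: field_simps)
  then show thesis
    using that dyadic_of_int by blast
qed

section \<open>Functions that are affine near a point\<close>

lemma eventually_nhds_interval:
  fixes x :: real
  assumes "\<forall>\<^sub>F t in nhds x. P t"
  obtains \<epsilon> where "\<epsilon> > 0" "\<And>t. t \<in> {x - \<epsilon><..<x + \<epsilon>} \<Longrightarrow> P t"
  using assms unfolding eventually_nhds_metric by (auto simp: dist_real_def abs_less_iff)

lemma affine_near_unique:
  assumes "affine_near f x a" "affine_near f x b"
  shows "a = b"
proof -
  obtain c d where "\<forall>\<^sub>F t in nhds x. f t = a * t + c" "\<forall>\<^sub>F t in nhds x. f t = b * t + d"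
    using assms by (auto simp: affine_near_def)
  then have "\<forall>\<^sub>F t in nhds x. a * t + c = b * t + d"
    by eventually_elim simp
  then obtain e where e: "e > 0" "\<And>t. t \<in> {x - e<..<x + e} \<Longrightarrow> a * t + c = b * t + d"
    using eventually_nhds_interval by blast
  \<comment> \<open>Two distinct points of the common neighbourhood determine the slope.\<close>
  have "a * x + c = b * x + d" "a * (x + e/2) + c = b * (x + e/2) + d"
    using e by auto
  then have "a * (e/2) = b * (e/2)"
    unfolding distrib_left by linarith
  then show ?thesis
    using e(1) by simp
qed

text \<open>The condition is open with a fixed slope, so the slope at x can be computed at any
  sufficiently close point.\<close>

lemma affine_near_eventually:
  assumes "affine_near f x a"
  shows "\<forall>\<^sub>F t in nhds x. affine_near f t a"
proof -
  obtain b where "\<forall>\<^sub>F t in nhds x. f t = a * t + b"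
    using assms by (auto simp: affine_near_def)
  then have "\<forall>\<^sub>F t in nhds x. \<forall>\<^sub>F s in nhds t. f s = a * s + b"
    by (simp add: eventually_eventually)
  then show ?thesis
    by eventually_elim (auto simp: affine_near_def)
qed

lemma affine_near_compose:
  assumes g: "affine_near g x a" and f: "affine_near f (g x) b" and c: "isCont g x"
  shows "affine_near (f \<circ> g) x (b * a)"
proof -
  obtain u v where u: "\<forall>\<^sub>F t in nhds x. g t = a * t + u" and v: "\<forall>\<^sub>F t in nhds (g x). f t = b * t + v"
    using f g by (auto simp: affine_near_def)
  have "filterlim g (nhds (g x)) (nhds x)"
    using c by (simp add: continuous_within tendsto_at_iff_tendsto_nhds)
  with v have "\<forall>\<^sub>F t in nhds x. f (g t) = b * g t + v"
    by (rule eventually_compose_filterlim)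
  with u have "\<forall>\<^sub>F t in nhds x. (f \<circ> g) t = b * a * t + (b * u + v)"
    by eventually_elim (simp add: algebra_simps)
  then show ?thesis
    by (auto simp: affine_near_def)
qed

text \<open>Only the identity f(g t) = t is assumed, so the result serves twice: with g the inverse
  of a homeomorphism f, and with the two exchanged.\<close>

lemma affine_near_inverse:
  assumes f: "affine_near f x a" and a: "a \<noteq> 0" and "f x = y" "g y = x"
    and c: "isCont g y" and inv: "\<And>t. f (g t) = t"
  shows "affine_near g y (1 / a)"
proof -
  obtain u where u: "\<forall>\<^sub>F t in nhds x. f t = a * t + u"
    using f by (auto simp: affine_near_def)
  have "filterlim g (nhds x) (nhds y)"
    using c \<open>g y = x\<close> by (auto simp: continuous_within tendsto_at_iff_tendsto_nhds)
  with u have "\<forall>\<^sub>F t in nhds y. f (g t) = a * g t + u"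
    by (rule eventually_compose_filterlim)
  then have "\<forall>\<^sub>F t in nhds y. g t = 1 / a * t + (- u / a)"
    by eventually_elim (use a inv in \<open>simp add: field_simps\<close>)
  then show ?thesis
    unfolding affine_near_def by (rule exI)
qed

lemma affine_near_strict_mono:
  assumes "strict_mono f" "affine_near f x a"
  shows "a \<noteq> 0"
proof
  assume "a = 0"
  then obtain c where "\<forall>\<^sub>F t in nhds x. f t = c"
    using assms(2) by (auto simp: affine_near_def)
  then obtain e where e: "e > 0" "\<And>t. t \<in> {x - e<..<x + e} \<Longrightarrow> f t = c"
    using eventually_nhds_interval by blast
  have "f x = f (x + e/2)"
    using e by simp
  moreover have "f x < f (x + e/2)"
    using strict_monoD[OF assms(1), of x "x + e/2"] e(1) by simp
  ultimately show False by simp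
qed

section \<open>Closure under composition and inversion\<close>

text \<open>The inverse homeomorphism, only asserted to exist in the definition, is identified with
  \<open>inv_into UNIV f\<close>, so that it becomes a fixed term.\<close>

lemma thompson_homeosD:
  assumes "f \<in> thompson_homeos"
  shows "homeomorphism UNIV UNIV f (inv_into UNIV f)" "strict_mono f" "bij f"
    "finite (breakpoints f \<inter> {a..b})" "breakpoints f \<subseteq> dyadic_rationals"
    "\<And>x a. affine_near f x a \<Longrightarrow> \<exists>k::int. a = 2 powi k"
    "\<And>x. x \<in> dyadic_rationals \<Longrightarrow> f x \<in> dyadic_rationals"
    "\<exists>(l::int) (r::int) (M::real). M > 0 \<and>
        (\<forall>t>M. f t = t + of_int r) \<and> (\<forall>t< -M. f t = t + of_int l)"
    "isCont f x" "isCont (inv_into UNIV f) y"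
proof -
  have sm: "strict_mono f"
    using assms by (simp add: thompson_homeos_def)
  obtain g where g: "homeomorphism UNIV UNIV f g"
    using assms by (auto simp: thompson_homeos_def)
  have "inv_into UNIV f = g"
    using g by (intro inv_equality) (auto simp: homeomorphism_def)
  with g show h: "homeomorphism UNIV UNIV f (inv_into UNIV f)" by simp
  show "bij f"
    using h strict_mono_imp_inj_on[OF sm] by (auto simp: bij_def homeomorphism_def)
  show "isCont f x" "isCont (inv_into UNIV f) y"
    using h by (simp_all add: homeomorphism_def continuous_on_eq_continuous_at)
qed (use assms in \<open>auto simp: thompson_homeos_def\<close>)

text \<open>A non-breakpoint with dyadic value has a dyadic point on the same affine piece, and the
  affine map of that piece is determined by this point and a power of two.\<close>

lemma thompson_vimage_dyadic:
  assumes f: "f \<in> thompson_homeos" and x: "f x \<in> dyadic_rationals"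
  shows "x \<in> dyadic_rationals"
proof (cases "x \<in> breakpoints f")
  case True
  then show ?thesis
    using thompson_homeosD(5)[OF f] by blast
next
  case False
  then obtain a where a: "affine_near f x a"
    by (auto simp: breakpoints_def)
  then obtain k :: int where k: "a = 2 powi k"
    using thompson_homeosD(6)[OF f] by blast
  obtain b where "\<forall>\<^sub>F t in nhds x. f t = a * t + b"
    using a by (auto simp: affine_near_def)
  then obtain e where e: "e > 0" "\<And>t. t \<in> {x - e<..<x + e} \<Longrightarrow> f t = a * t + b"
    using eventually_nhds_interval by blast
  obtain t where t: "t \<in> dyadic_rationals" "x - e < t" "t < x + e"
    using dyadic_dense[of "x - e" "x + e"] e(1) by auto
  have "f t = a * t + b" "f x = a * x + b"
    using e t by auto
  then have "f t - f x = a * (t - x)"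
    by (simp add: algebra_simps)
  moreover have "2 powi (- k) * a = 1"
    using k by (simp add: power_int_minus)
  ultimately have "2 powi (- k) * (f t - f x) = t - x"
    by (metis mult.assoc mult_1)
  then have "x = t - 2 powi (- k) * (f t - f x)"
    by simp
  moreover have "f t \<in> dyadic_rationals"
    using thompson_homeosD(7)[OF f] t(1) by blast
  ultimately show ?thesis
    using t(1) x by (metis dyadic_diff dyadic_mult dyadic_power2)
qed

lemma id_thompson: "id \<in> thompson_homeos"
proof -
  have aff: "affine_near id x 1" for x
    by (auto simp: affine_near_def intro: exI[of _ 0])
  then have "breakpoints id = {}"
    by (auto simp: breakpoints_def)
  moreover have "\<exists>k::int. a = 2 powi k" if "affine_near id x a" for x a
    using affine_near_unique[OF that aff] by (intro exI[of _ 0]) simp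
  moreover have "homeomorphism UNIV UNIV id (id :: real \<Rightarrow> real)"
    by (simp add: homeomorphism_def)
  moreover have "\<exists>(l::int) (r::int) (M::real). M > 0 \<and>
      (\<forall>t>M. id t = t + of_int r) \<and> (\<forall>t< -M. id t = t + of_int l)"
    by (intro exI[of _ 0] exI[of _ 1]) simp
  ultimately show ?thesis
    by (auto simp: thompson_homeos_def strict_mono_def)
qed

lemma breakpoints_compose:
  assumes "isCont g x" "x \<in> breakpoints (f \<circ> g)"
  shows "x \<in> breakpoints g \<or> g x \<in> breakpoints f"
  using assms affine_near_compose[of g x _ f] by (auto simp: breakpoints_def)

text \<open>By local finiteness the breakpoints in [x, x + 1] other than x form a closed set not
  containing x, so a right neighbourhood of x without x itself avoids them.\<close>

lemma eventually_not_breakpoint: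
  assumes "finite (breakpoints f \<inter> {x..x + 1})"
  shows "\<forall>\<^sub>F t in at_right x. t \<notin> breakpoints f"
proof -
  have "open (- (breakpoints f \<inter> {x..x + 1} - {x}))"
    using assms by (intro open_Compl finite_imp_closed finite_Diff)
  then have "\<forall>\<^sub>F t in nhds x. t \<in> - (breakpoints f \<inter> {x..x + 1} - {x})"
    by (rule eventually_nhds_in_open) simp
  then have "\<forall>\<^sub>F t in at_right x. t \<in> - (breakpoints f \<inter> {x..x + 1} - {x})"
    unfolding eventually_at_filter by (rule eventually_mono) auto
  moreover have "\<forall>\<^sub>F t in at_right x. t \<in> {x<..<x+1}"
    by (rule eventually_at_right_real) simp
  ultimately show ?thesis
    by eventually_elim auto
qed

lemma compose_thompson:
  assumes f: "f \<in> thompson_homeos" and g: "g \<in> thompson_homeos"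
  shows "f \<circ> g \<in> thompson_homeos"
proof -
  note F = thompson_homeosD[OF f] and G = thompson_homeosD[OF g]
  have bp: "breakpoints (f \<circ> g) \<subseteq> breakpoints g \<union> g -` breakpoints f"
    using breakpoints_compose G(9) by blast
  have fin: "finite (breakpoints (f \<circ> g) \<inter> {a..b})" for a b
  proof (rule finite_subset)
    show "breakpoints (f \<circ> g) \<inter> {a..b} \<subseteq>
        (breakpoints g \<inter> {a..b}) \<union> g -` (breakpoints f \<inter> {g a..g b})"
      using bp by (auto simp: strict_mono_less_eq[OF G(2)])
    show "finite ((breakpoints g \<inter> {a..b}) \<union> g -` (breakpoints f \<inter> {g a..g b}))"
      using F(4) G(4) bij_is_inj[OF G(3)] by (intro finite_UnI finite_vimageI)
  qed
  have dy: "breakpoints (f \<circ> g) \<subseteq> dyadic_rationals"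
    using bp F(5) G(5) thompson_vimage_dyadic[OF g] by blast
  \<comment> \<open>Breakpoints of g at x and of f at g(x) may cancel in the composite. The slope c
    is therefore read off at a point t slightly to the right of x, where both factors are affine and
    c is the product of their slopes.\<close>
  have slope: "\<exists>k::int. c = 2 powi k" if c: "affine_near (f \<circ> g) x c" for x c
  proof -
    have "\<forall>\<^sub>F t in at_right x. affine_near (f \<circ> g) t c"
      using affine_near_eventually[OF c] unfolding eventually_at_filter by (rule eventually_mono) simp
    moreover have "\<forall>\<^sub>F t in at_right x. t \<notin> breakpoints g"
      by (rule eventually_not_breakpoint[OF G(4)])
    moreover have "\<forall>\<^sub>F t in at_right x. g t \<notin> breakpoints f"
    proof -
      \<comment> \<open>Being continuous and strictly increasing, g carries right neighbourhoods of
        x into right neighbourhoods of g(x), so the points g(t) also avoid the breakpoints of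
        f.\<close>
      have "\<forall>\<^sub>F t in at_right x. g t \<in> {g x<..} \<and> g t \<noteq> g x"
        using eventually_at_right_less[of x]
        by eventually_elim (simp add: strict_mono_less[OF G(2)] less_imp_neq[symmetric] strict_mono_eq[OF G(2)])
      moreover have "(g \<longlongrightarrow> g x) (at_right x)"
        using continuous_at_imp_continuous_at_within[OF G(9)] by (simp add: continuous_within)
      ultimately have "filterlim g (at_right (g x)) (at_right x)"
        by (simp add: filterlim_at)
      then show ?thesis
        by (rule eventually_compose_filterlim[OF eventually_not_breakpoint[OF F(4)]])
    qed
    ultimately have "\<forall>\<^sub>F t in at_right x. affine_near (f \<circ> g) t c \<and> t \<notin> breakpoints g \<and> g t \<notin> breakpoints f"
      by eventually_elim simp
    then obtain t where t: "affine_near (f \<circ> g) t c" "t \<notin> breakpoints g" "g t \<notin> breakpoints f"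
      using eventually_happens'[of "at_right x"] trivial_limit_at_right_real by blast
    obtain a b where ab: "affine_near g t a" "affine_near f (g t) b"
      using t by (auto simp: breakpoints_def)
    obtain k l :: int where "a = 2 powi k" "b = 2 powi l"
      using F(6)[OF ab(2)] G(6)[OF ab(1)] by blast
    moreover have "c = b * a"
      using affine_near_unique[OF t(1) affine_near_compose[OF ab G(9)]] .
    ultimately have "c = 2 powi (l + k)"
      by (simp add: power_int_add)
    then show ?thesis by blast
  qed
  obtain l r :: int and M where M: "M > 0" "\<forall>t>M. f t = t + of_int r" "\<forall>t< -M. f t = t + of_int l"
    using F(8) by blast
  obtain l' r' :: int and M' where M': "M' > 0" "\<forall>t>M'. g t = t + of_int r'" "\<forall>t< -M'. g t = t + of_int l'"
    using G(8) by blast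
  \<comment> \<open>Beyond N the map g is already a translation, and the absolute values ensure that
    the translated point is still in the range where f is one.\<close>
  define N where "N = M + M' + \<bar>of_int r'\<bar> + \<bar>of_int l'\<bar>"
  have "N > 0 \<and> (\<forall>t>N. (f \<circ> g) t = t + of_int (r + r')) \<and> (\<forall>t< -N. (f \<circ> g) t = t + of_int (l + l'))"
    using M M' by (auto simp: N_def)
  then have "\<exists>(l::int) (r::int) N. N > 0 \<and> (\<forall>t>N. (f \<circ> g) t = t + of_int r) \<and> (\<forall>t< -N. (f \<circ> g) t = t + of_int l)"
    by blast
  moreover have "\<exists>h. homeomorphism UNIV UNIV (f \<circ> g) h"
    using homeomorphism_compose[OF G(1) F(1)] by blast
  moreover have "strict_mono (f \<circ> g)"
    using F(2) G(2) by (simp add: strict_mono_def)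
  ultimately show ?thesis
    using fin dy slope F(7) G(7) unfolding thompson_homeos_def by auto
qed

lemma inverse_thompson:
  assumes f: "f \<in> thompson_homeos"
  shows "inv_into UNIV f \<in> thompson_homeos"
proof -
  note F = thompson_homeosD[OF f]
  have fi: "f (inv_into UNIV f y) = y" and if': "inv_into UNIV f (f x) = x" for x y
    using F(1) by (simp_all add: homeomorphism_def)
  have sm: "strict_mono (inv_into UNIV f)"
  proof (rule strict_monoI)
    fix x y :: real assume "x < y"
    then show "inv_into UNIV f x < inv_into UNIV f y"
      using strict_mono_less[OF F(2), of "inv_into UNIV f x" "inv_into UNIV f y"] by (simp add: fi)
  qed
  \<comment> \<open>Where f is affine with nonzero slope its inverse is affine too, so a breakpoint
    of the inverse can only sit over a breakpoint of f.\<close>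
  have bp: "breakpoints (inv_into UNIV f) \<subseteq> f ` breakpoints f"
  proof
    fix y assume y: "y \<in> breakpoints (inv_into UNIV f)"
    have "inv_into UNIV f y \<in> breakpoints f"
    proof (rule ccontr)
      assume "inv_into UNIV f y \<notin> breakpoints f"
      then obtain a where a: "affine_near f (inv_into UNIV f y) a"
        by (auto simp: breakpoints_def)
      have "affine_near (inv_into UNIV f) y (1 / a)"
        by (rule affine_near_inverse[OF a affine_near_strict_mono[OF F(2) a]]) (simp_all add: fi F(10))
      then show False
        using y by (auto simp: breakpoints_def)
    qed
    then show "y \<in> f ` breakpoints f"
      using fi by (metis imageI)
  qed
  have fin: "finite (breakpoints (inv_into UNIV f) \<inter> {a..b})" for a b
  proof (rule finite_subset)
    show "breakpoints (inv_into UNIV f) \<inter> {a..b} \<subseteq> f ` (breakpoints f \<inter> {inv_into UNIV f a..inv_into UNIV f b})"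
    proof
      fix y assume y: "y \<in> breakpoints (inv_into UNIV f) \<inter> {a..b}"
      then obtain x where x: "x \<in> breakpoints f" "y = f x"
        using bp by blast
      then have "inv_into UNIV f a \<le> x" "x \<le> inv_into UNIV f b"
        using y if'[of x] strict_mono_less_eq[OF sm, of a y] strict_mono_less_eq[OF sm, of y b] by auto
      then show "y \<in> f ` (breakpoints f \<inter> {inv_into UNIV f a..inv_into UNIV f b})"
        using x by auto
    qed
    show "finite (f ` (breakpoints f \<inter> {inv_into UNIV f a..inv_into UNIV f b}))"
      using F(4) by simp
  qed
  have slope: "\<exists>k::int. a = 2 powi k" if a: "affine_near (inv_into UNIV f) y a" for y a
  proof -
    have "affine_near f (inv_into UNIV f y) (1 / a)"
      by (rule affine_near_inverse[OF a affine_near_strict_mono[OF sm a]]) (simp_all add: fi F(9) if')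
    then obtain k :: int where "1 / a = 2 powi k"
      using F(6) by blast
    then have "a = 2 powi (- k)"
      by (metis inverse_eq_divide inverse_inverse_eq power_int_minus)
    then show ?thesis by blast
  qed
  obtain l r :: int and M where M: "M > 0" "\<forall>t>M. f t = t + of_int r" "\<forall>t< -M. f t = t + of_int l"
    using F(8) by blast
  \<comment> \<open>For t > N the point t - r still exceeds M, so f translates it to t; likewise
    with l on the negative side.\<close>
  define N where "N = M + \<bar>of_int r\<bar> + \<bar>of_int l\<bar>"
  have "inv_into UNIV f t = t - of_int r" if "t > N" for t
    using M(2)[rule_format, of "t - of_int r"] that if'[of "t - of_int r"] by (simp add: N_def)
  moreover have "inv_into UNIV f t = t - of_int l" if "t < - N" for t
    using M(3)[rule_format, of "t - of_int l"] that if'[of "t - of_int l"] by (simp add: N_def)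
  moreover have "N > 0"
    using M(1) by (simp add: N_def)
  ultimately have "N > 0 \<and> (\<forall>t>N. inv_into UNIV f t = t + of_int (- r)) \<and> (\<forall>t< -N. inv_into UNIV f t = t + of_int (- l))"
    by simp
  then have "\<exists>(l::int) (r::int) N. N > 0 \<and> (\<forall>t>N. inv_into UNIV f t = t + of_int r) \<and> (\<forall>t< -N. inv_into UNIV f t = t + of_int l)"
    by blast
  moreover have "\<exists>h. homeomorphism UNIV UNIV (inv_into UNIV f) h"
    using F(1) homeomorphism_symD by blast
  moreover have "breakpoints (inv_into UNIV f) \<subseteq> dyadic_rationals"
    using bp F(5) F(7) by blast
  moreover have "inv_into UNIV f ` dyadic_rationals \<subseteq> dyadic_rationals"
    using thompson_vimage_dyadic[OF f] fi by (metis image_subsetI)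
  ultimately show ?thesis
    using fin slope sm unfolding thompson_homeos_def by blast
qed

lemma group_Thompson_F: "group Thompson_F"
proof (rule groupI)
  fix f assume "f \<in> carrier Thompson_F"
  then have "inv_into UNIV f \<in> carrier Thompson_F \<and> inv_into UNIV f \<otimes>\<^bsub>Thompson_F\<^esub> f = \<one>\<^bsub>Thompson_F\<^esub>"
    using thompson_homeosD(3)[of f] inverse_thompson by (simp add: Thompson_F_def bij_def)
  then show "\<exists>g\<in>carrier Thompson_F. g \<otimes>\<^bsub>Thompson_F\<^esub> f = \<one>\<^bsub>Thompson_F\<^esub>"
    by blast
qed (auto simp: Thompson_F_def id_thompson compose_thompson o_assoc)

theorem theorem5p1:
  fixes S :: "(real \<Rightarrow> real) set"
  assumes "finite_generating_set Thompson_F S"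
  shows "group_hom (Com Thompson_F) (QI Thompson_F S) (Com_to_QI Thompson_F S) \<and>
         inj_on (Com_to_QI Thompson_F S) (carrier (Com Thompson_F))"
proof -
  interpret fg_group Thompson_F S
    using assms group_Thompson_F by (simp add: fg_group_def fg_group_axioms_def)
  show ?thesis
    using Com_to_QI_group_hom Com_to_QI_inj by blast
qed

end
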